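(* Define the following $K_w+2$ rate-memory pairs $(R_t, M_t)$, $t=0,1,\ldots,K_w+1$: (i) $R_0 := F\left(\frac{K_w}{1-\delta_w}+\frac{K_s}{1-\delta_s}\right)^{-1}$, $M_0 := 0$; (ii) for each $t\in\{1,\ldots,K_w\}$: $$R_t := \frac{F(1-\delta_w)\left(1+\frac{K_w-t+1}{tK_s}\cdot\frac{\delta_w-\delta_s}{1-\delta_w}\right)}{\frac{K_w-t+1}{t}\left(1+\frac{K_w-t}{(t+1)K_s}\cdot\frac{\delta_w-\delta_s}{1-\delta_w}\right)+K_s\frac{1-\delta_w}{1-\delta_s}},$$ $$M_t := R_t\,\frac{D}{K_w}\left(t-\left(1+\frac{K_w-t+1}{tK_s}\cdot\frac{\delta_w-\delta_s}{1-\delta_w}\right)^{-1}\right);$$ (iii) $R_{K_w+1} := F\frac{1-\delta_s}{K_s}$, $M_{K_w+1} := DF\frac{1-\delta_s}{K_s}$. Then the capacity-memory tradeoff satisfies $$C(M)\ \geq\ \text{upper convex hull}\big\{(R_t,M_t)\colon t=0,1,\ldots,K_w+1\big\}.$$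
   Context: Consider a memoryless packet-erasure broadcast channel with input alphabet $\{0,1\}^F$ (packets of $F$ bits) and output alphabet $\{0,1\}^F\cup\{\Delta\}$ at each of $K=K_w+K_s$ receivers, where receiver $k$ receives the input packet with probability $1-\delta_k$ and the erasure symbol $\Delta$ with probability $\delta_k$. There are $K_w$ weak receivers, each with erasure probability $\delta_w$ and each equipped with a cache memory of $nM$ bits, and $K_s$ strong receivers, each with erasure probability $\delta_s$, $0<\delta_s\le\delta_w\le 1$, and no cache memory. A transmitter has a library of $D\ge K$ independent messages $W_1,\ldots,W_D$, each uniformly distributed over $\{1,\ldots,\lfloor 2^{nR}\rfloor\}$. In an error-free caching phase, before the demands are known, each weak receiver $i$ stores $V_i=g_i(W_1,\ldots,W_D)\in\{1,\ldots,\lfloor 2^{nM}\rfloor\}$. In the delivery phase, each receiver $k$ demands one message $W_{d_k}$, where the demand vector $(d_1,\ldots,d_K)$ can be any element of $\{1,\ldots,D\}^K$ and is known to the transmitter and all receivers; the transmitter sends a length-$n$ codeword depending on the demand vector and the library, weak receivers decode from their channel outputs and cache contents, strong receivers from their channel outputs only. A pair $(R,M)$ is achievable if the worst-case (over all demand vectors) probability that some receiver decodes its demanded message incorrectly can be made arbitrarily small for sufficiently large $n$. The capacity-memory tradeoff $C(M)$ is the supremum of all rates $R$ such that $(R,M)$ is achievable.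
   Formalization: The case δ_w = 1 is excluded, and K_s ≥ 1 is assumed, because the formulas for R_t and M_t divide by 1−δ_w and by K_s; erasures are taken independent across receivers. *)

theory Defs
  imports "HOL-Analysis.Analysis" "HOL-Library.Extended_Real"
begin

text \<open>Receivers are indexed 0..<K with K = Kw + Ks; receivers k < Kw are the weak ones
  (erasure probability dw, cache of nM bits), receivers Kw <= k < K are the strong ones
  (erasure probability ds, no cache). Packets are bit lists of length F; an erasure is None.
  Messages are indexed 0..<D, a library is a function W with W j in {1..floor(2^(nR))}.\<close>

definition erasure_prob :: "nat \<Rightarrow> real \<Rightarrow> real \<Rightarrow> nat \<Rightarrow> real" where
  "erasure_prob Kw dw ds k = (if k < Kw then dw else ds)"

definition msg_size :: "nat \<Rightarrow> real \<Rightarrow> nat" where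
  "msg_size n R = nat \<lfloor>2 powr (real n * R)\<rfloor>"

definition libraries :: "nat \<Rightarrow> nat \<Rightarrow> real \<Rightarrow> (nat \<Rightarrow> nat) set" where
  "libraries D n R = PiE {..<D} (\<lambda>_. {1..msg_size n R})"

text \<open>Erasure pattern: e (k,t) = True iff receiver k's t-th channel output is erased.\<close>
definition erasure_patterns :: "nat \<Rightarrow> nat \<Rightarrow> (nat \<times> nat \<Rightarrow> bool) set" where
  "erasure_patterns K n = PiE ({..<K} \<times> {..<n}) (\<lambda>_. UNIV)"

definition erasure_weight ::
  "nat \<Rightarrow> real \<Rightarrow> real \<Rightarrow> nat \<Rightarrow> nat \<Rightarrow> (nat \<times> nat \<Rightarrow> bool) \<Rightarrow> real" where
  "erasure_weight Kw dw ds K n e =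
     (\<Prod>k<K. \<Prod>t<n. if e (k, t) then erasure_prob Kw dw ds k else 1 - erasure_prob Kw dw ds k)"

definition channel_output ::
  "nat \<Rightarrow> (nat \<Rightarrow> bool list) \<Rightarrow> (nat \<times> nat \<Rightarrow> bool) \<Rightarrow> nat \<Rightarrow> nat \<Rightarrow> bool list option" where
  "channel_output n x e k = (\<lambda>t. if t < n \<and> \<not> e (k, t) then Some (x t) else None)"

definition valid_demand :: "nat \<Rightarrow> nat \<Rightarrow> (nat \<Rightarrow> nat) \<Rightarrow> bool" where
  "valid_demand K D d \<longleftrightarrow> (\<forall>k<K. d k < D)"

text \<open>Worst-case-relevant error probability for a fixed demand vector d of a code
  (cache, enc, dec): probability (uniform library, independent erasures) that some receiver
  decodes its demanded message incorrectly. Strong receivers get a constant (0) instead of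
  a cache content, i.e. they decode from channel outputs only.\<close>
definition error_prob ::
  "nat \<Rightarrow> nat \<Rightarrow> real \<Rightarrow> real \<Rightarrow> nat \<Rightarrow> nat \<Rightarrow> real
   \<Rightarrow> (nat \<Rightarrow> (nat \<Rightarrow> nat) \<Rightarrow> nat)
   \<Rightarrow> ((nat \<Rightarrow> nat) \<Rightarrow> (nat \<Rightarrow> nat) \<Rightarrow> nat \<Rightarrow> bool list)
   \<Rightarrow> (nat \<Rightarrow> (nat \<Rightarrow> nat) \<Rightarrow> (nat \<Rightarrow> bool list option) \<Rightarrow> nat \<Rightarrow> nat)
   \<Rightarrow> (nat \<Rightarrow> nat) \<Rightarrow> real" where
  "error_prob Kw Ks dw ds D n R cache enc dec d =
     (\<Sum>W\<in>libraries D n R. \<Sum>e\<in>erasure_patterns (Kw + Ks) n.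
        (1 / real (card (libraries D n R))) * erasure_weight Kw dw ds (Kw + Ks) n e *
        (if (\<exists>k < Kw + Ks. dec k d (channel_output n (enc d W) e k)
                               (if k < Kw then cache k W else 0) \<noteq> W (d k))
         then 1 else 0))"

definition valid_code ::
  "nat \<Rightarrow> nat \<Rightarrow> nat \<Rightarrow> nat \<Rightarrow> nat \<Rightarrow> real \<Rightarrow> real
   \<Rightarrow> (nat \<Rightarrow> (nat \<Rightarrow> nat) \<Rightarrow> nat)
   \<Rightarrow> ((nat \<Rightarrow> nat) \<Rightarrow> (nat \<Rightarrow> nat) \<Rightarrow> nat \<Rightarrow> bool list) \<Rightarrow> bool" where
  "valid_code F Kw Ks D n R M cache enc \<longleftrightarrow>
     (\<forall>i<Kw. \<forall>W\<in>libraries D n R. cache i W \<in> {1..nat \<lfloor>2 powr (real n * M)\<rfloor>}) \<and>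
     (\<forall>d W t. valid_demand (Kw + Ks) D d \<longrightarrow> W \<in> libraries D n R \<longrightarrow> t < n \<longrightarrow>
        length (enc d W t) = F)"

definition achievable ::
  "nat \<Rightarrow> nat \<Rightarrow> nat \<Rightarrow> real \<Rightarrow> real \<Rightarrow> nat \<Rightarrow> real \<Rightarrow> real \<Rightarrow> bool" where
  "achievable F Kw Ks dw ds D R M \<longleftrightarrow> 0 \<le> R \<and>
     (\<forall>\<epsilon>>0. \<exists>N. \<forall>n\<ge>N. \<exists>cache enc dec.
        valid_code F Kw Ks D n R M cache enc \<and>
        (\<forall>d. valid_demand (Kw + Ks) D d \<longrightarrow>
             error_prob Kw Ks dw ds D n R cache enc dec d \<le> \<epsilon>))"

definition capacity_memory ::
  "nat \<Rightarrow> nat \<Rightarrow> nat \<Rightarrow> real \<Rightarrow> real \<Rightarrow> nat \<Rightarrow> real \<Rightarrow> ereal" where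
  "capacity_memory F Kw Ks dw ds D M =
     (SUP R \<in> {R. achievable F Kw Ks dw ds D R M}. ereal R)"

definition Rpt :: "nat \<Rightarrow> nat \<Rightarrow> nat \<Rightarrow> real \<Rightarrow> real \<Rightarrow> nat \<Rightarrow> real" where
  "Rpt F Kw Ks dw ds t =
    (let g = (dw - ds) / (1 - dw) in
     if t = 0 then real F / (real Kw / (1 - dw) + real Ks / (1 - ds))
     else if t \<le> Kw then
       real F * (1 - dw) * (1 + (real Kw - real t + 1) / (real t * real Ks) * g) /
       ((real Kw - real t + 1) / real t *
          (1 + (real Kw - real t) / ((real t + 1) * real Ks) * g)
        + real Ks * (1 - dw) / (1 - ds))
     else real F * (1 - ds) / real Ks)"

definition Mpt :: "nat \<Rightarrow> nat \<Rightarrow> nat \<Rightarrow> real \<Rightarrow> real \<Rightarrow> nat \<Rightarrow> nat \<Rightarrow> real" where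
  "Mpt F Kw Ks dw ds D t =
    (let g = (dw - ds) / (1 - dw) in
     if t = 0 then 0
     else if t \<le> Kw then
       Rpt F Kw Ks dw ds t * real D / real Kw *
         (real t - 1 / (1 + (real Kw - real t + 1) / (real t * real Ks) * g))
     else real D * real F * (1 - ds) / real Ks)"

text \<open>Upper convex hull of the points (Ms t, Rs t), t = 0..N, evaluated at memory M:
  supremum of the rates of convex combinations with memory exactly M
  (-\<infinity> outside the hull's domain).\<close>
definition upper_convex_hull :: "(nat \<Rightarrow> real) \<Rightarrow> (nat \<Rightarrow> real) \<Rightarrow> nat \<Rightarrow> real \<Rightarrow> ereal" where
  "upper_convex_hull Rs Ms N M =
     (SUP l \<in> {l. (\<forall>t\<le>N. 0 \<le> l t) \<and> (\<Sum>t\<le>N. l t) = 1 \<and> (\<Sum>t\<le>N. l t * Ms t) = M}.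
        ereal (\<Sum>t\<le>N. l t * Rs t))"

end

theory Submission
  imports Defs "HOL-Number_Theory.Cong"
begin

text \<open>
  Split every message into pieces indexed by the sets \<open>S\<close> of weak receivers; receiver \<open>i\<close> caches
  the pieces with \<open>i \<in> S\<close>. For every \<open>S\<close> a fraction of the channel uses carries the sum over
  \<open>i \<in> S\<close> of the piece \<open>S - {i}\<close> of the message demanded by \<open>i\<close>, jointly encoded with the pieces
  \<open>S\<close> of the messages demanded by the strong receivers. The weak receivers in \<open>S\<close> know the latter
  from their caches, so they only have to resolve the sum at rate \<open>F (1 - \<delta>\<^sub>w)\<close>, while the strong
  receivers resolve everything at rate \<open>F (1 - \<delta>\<^sub>s)\<close>. A random codebook achieves this with error
  probability exponentially small in \<open>n\<close>, for every library, so the payloads need not be uniformly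
  distributed. The conditions on the piece rates and time fractions are linear, so convex
  combinations of the corner points need no separate time-sharing argument. The corner point \<open>t\<close>
  uses only pieces of sizes \<open>t - 1\<close> and \<open>t\<close>, in the ratio for which both decoding conditions of the
  jobs of size \<open>t\<close> are tight.
\<close>

section \<open>Random codebooks\<close>

lemma card_PiE_tied_le:
  assumes "finite I" "finite X" "B \<subseteq> I" "h ` B \<subseteq> I - B"
  shows "card {f \<in> I \<rightarrow>\<^sub>E X. \<forall>x\<in>B. f x = f (h x)} * card X ^ card B \<le> card (I \<rightarrow>\<^sub>E X)"
proof -
  let ?tied = "{f \<in> I \<rightarrow>\<^sub>E X. \<forall>x\<in>B. f x = f (h x)}"
  have "inj_on (\<lambda>f. restrict f (I - B)) ?tied"
  proof (rule inj_onI)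
    fix f g assume f: "f \<in> ?tied" and g: "g \<in> ?tied"
      and "restrict f (I - B) = restrict g (I - B)"
    then have eq: "f x = g x" if "x \<in> I - B" for x using that by (metis restrict_apply')
    show "f = g"
    proof (rule PiE_ext)
      show "f \<in> I \<rightarrow>\<^sub>E X" "g \<in> I \<rightarrow>\<^sub>E X" using f g by auto
      fix x assume "x \<in> I"
      show "f x = g x"
      proof (cases "x \<in> B")
        case True
        then have "f (h x) = g (h x)" using eq assms(4) by blast
        then show ?thesis using f g True by simp
      next
        case False
        then show ?thesis using eq \<open>x \<in> I\<close> by simp
      qed
    qed
  qed
  moreover have "(\<lambda>f. restrict f (I - B)) ` ?tied \<subseteq> I - B \<rightarrow>\<^sub>E X" by auto
  ultimately have "card ?tied \<le> card (I - B \<rightarrow>\<^sub>E X)"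
    using assms by (intro card_inj_on_le finite_PiE) auto
  also have "\<dots> = card X ^ card (I - B)" using assms by (simp add: card_PiE)
  finally have "card ?tied * card X ^ card B \<le> card X ^ (card (I - B) + card B)"
    by (simp add: power_add)
  also have "card (I - B) + card B = card I"
    using assms by (simp add: card_Diff_subset card_mono finite_subset)
  finally show ?thesis using assms by (simp add: card_PiE)
qed

definition confusable :: "('t \<times> 'u \<Rightarrow> 'x) \<Rightarrow> 't set \<Rightarrow> 'u set \<Rightarrow> 'u \<Rightarrow> bool" where
  "confusable C T S u \<longleftrightarrow> (\<exists>v\<in>S - {u}. \<forall>\<tau>\<in>T. C (\<tau>, v) = C (\<tau>, u))"

lemma card_confusable_le:
  assumes fin: "finite A" "finite U" "finite X" and sub: "T \<subseteq> A" "S \<subseteq> U" "u \<in> U"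
  shows "card {C \<in> A \<times> U \<rightarrow>\<^sub>E X. confusable C T S u} * card X ^ card T
    \<le> card S * card (A \<times> U \<rightarrow>\<^sub>E X)"
proof -
  let ?codebooks = "A \<times> U \<rightarrow>\<^sub>E X"
  let ?agree = "\<lambda>v. {C \<in> ?codebooks. \<forall>\<tau>\<in>T. C (\<tau>, v) = C (\<tau>, u)}"
  have "finite S" using sub(2) fin(2) by (rule finite_subset)
  have agree: "card (?agree v) * card X ^ card T \<le> card ?codebooks" if "v \<in> S - {u}" for v
  proof -
    have "card {C \<in> ?codebooks. \<forall>x\<in>T \<times> {v}. C x = C (fst x, u)} * card X ^ card (T \<times> {v})
      \<le> card ?codebooks"
      using fin sub that by (intro card_PiE_tied_le) auto
    then show ?thesis by (simp add: card_cartesian_product)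
  qed
  have "{C \<in> ?codebooks. confusable C T S u} = (\<Union>v\<in>S - {u}. ?agree v)"
    by (auto simp: confusable_def)
  then have "card {C \<in> ?codebooks. confusable C T S u} \<le> (\<Sum>v\<in>S - {u}. card (?agree v))"
    using card_UN_le[of "S - {u}" ?agree] \<open>finite S\<close> by simp
  then have "card {C \<in> ?codebooks. confusable C T S u} * card X ^ card T
    \<le> (\<Sum>v\<in>S - {u}. card (?agree v) * card X ^ card T)"
    by (simp flip: sum_distrib_right)
  also have "\<dots> \<le> card (S - {u}) * card ?codebooks"
    using sum_mono[OF agree, of "S - {u}"] by simp
  also have "\<dots> \<le> card S * card ?codebooks"
    using \<open>finite S\<close> by (intro mult_right_mono card_mono) auto
  finally show ?thesis .
qed

lemma min_one_le_powr:
  fixes x \<rho> :: real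
  assumes "0 \<le> x" "0 < \<rho>" "\<rho> \<le> 1"
  shows "min 1 x \<le> x powr \<rho>"
proof (cases "x \<le> 1")
  case True
  then have "x powr 1 \<le> x powr \<rho>" using assms by (intro powr_mono') auto
  then show ?thesis using assms(1) True by simp
next
  case False
  then show ?thesis using assms by (simp add: ge_one_powr_ge_zero)
qed

text \<open>Gallager's trick: raising the union bound to a small power \<open>\<rho>\<close> keeps the later average over
  the erasures multiplicative and still reaches every rate below capacity as \<open>\<rho>\<close> tends to 0.\<close>

lemma card_confusable_le_powr:
  fixes \<rho> :: real
  assumes fin: "finite A" "finite U" "finite X" and "X \<noteq> {}"
    and sub: "T \<subseteq> A" "S \<subseteq> U" "u \<in> U" and \<rho>: "0 < \<rho>" "\<rho> \<le> 1"
  shows "real (card {C \<in> A \<times> U \<rightarrow>\<^sub>E X. confusable C T S u})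
    \<le> real (card (A \<times> U \<rightarrow>\<^sub>E X)) * (real (card S) / real (card X) ^ card T) powr \<rho>"
proof -
  let ?codebooks = "A \<times> U \<rightarrow>\<^sub>E X" and ?x = "real (card S) / real (card X) ^ card T"
  let ?bad = "{C \<in> ?codebooks. confusable C T S u}"
  have "0 < real (card X) ^ card T" using fin(3) \<open>X \<noteq> {}\<close> by (simp add: card_gt_0_iff)
  moreover have "real (card ?bad) * real (card X) ^ card T \<le> real (card S) * real (card ?codebooks)"
    using of_nat_mono[OF card_confusable_le[OF fin sub]] by simp
  ultimately have union_bound: "real (card ?bad) \<le> real (card ?codebooks) * ?x"
    by (simp add: pos_le_divide_eq mult.commute)
  have "card ?bad \<le> card ?codebooks"
    using fin by (intro card_mono finite_PiE) auto
  then have "real (card ?bad) \<le> real (card ?codebooks) * min 1 ?x"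
    using union_bound by (simp add: min_def)
  also have "\<dots> \<le> real (card ?codebooks) * ?x powr \<rho>"
    using \<rho> by (intro mult_left_mono min_one_le_powr) auto
  finally show ?thesis .
qed

section \<open>Erasures\<close>

lemma erasure_weight_nonneg:
  assumes "0 \<le> ds" "ds \<le> 1" "0 \<le> dw" "dw \<le> 1"
  shows "0 \<le> erasure_weight Kw dw ds K n e"
  unfolding erasure_weight_def erasure_prob_def using assms by (auto intro!: prod_nonneg)

lemma erasure_weight_generating_function:
  fixes Kw :: nat and dw ds z :: real
  assumes k: "k < K" and T: "T \<subseteq> {..<n}"
  defines "\<delta> \<equiv> erasure_prob Kw dw ds k"
  shows "(\<Sum>e\<in>erasure_patterns K n. erasure_weight Kw dw ds K n e * z ^ card {\<tau>\<in>T. \<not> e (k, \<tau>)})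
    = (\<delta> + (1 - \<delta>) * z) ^ card T"
proof -
  let ?uses = "{..<K} \<times> {..<n}"
  let ?factor = "\<lambda>i erased.
    (if erased then erasure_prob Kw dw ds (fst i) else 1 - erasure_prob Kw dw ds (fst i))
    * (if fst i = k \<and> snd i \<in> T \<and> \<not> erased then z else 1)"
  have "finite T" using T finite_subset by blast
  have factorization: "erasure_weight Kw dw ds K n e * z ^ card {\<tau>\<in>T. \<not> e (k, \<tau>)}
    = (\<Prod>i\<in>?uses. ?factor i (e i))" for e
  proof -
    have "(\<Prod>i\<in>?uses. if fst i = k \<and> snd i \<in> T \<and> \<not> e i then z else 1)
      = (\<Prod>i\<in>Pair k ` {\<tau>\<in>T. \<not> e (k, \<tau>)}. z)"
      by (rule prod.mono_neutral_cong_right) (use k T in auto)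
    also have "\<dots> = z ^ card {\<tau>\<in>T. \<not> e (k, \<tau>)}"
      by (simp add: card_image inj_on_def)
    finally show ?thesis
      unfolding prod.distrib erasure_weight_def
      by (simp add: prod.cartesian_product case_prod_unfold)
  qed
  have "(\<Sum>e\<in>erasure_patterns K n. \<Prod>i\<in>?uses. ?factor i (e i))
    = (\<Prod>i\<in>?uses. \<Sum>erased\<in>UNIV. ?factor i erased)"
    unfolding erasure_patterns_def by (rule prod_sum_PiE[symmetric]) auto
  also have "\<dots> = (\<Prod>i\<in>?uses. if fst i = k \<and> snd i \<in> T then \<delta> + (1 - \<delta>) * z else 1)"
    by (rule prod.cong) (auto simp: UNIV_bool \<delta>_def)
  also have "\<dots> = (\<Prod>i\<in>Pair k ` T. \<delta> + (1 - \<delta>) * z)"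
    by (rule prod.mono_neutral_cong_right) (use k T in auto)
  also have "\<dots> = (\<delta> + (1 - \<delta>) * z) ^ card T"
    by (simp add: card_image inj_on_def)
  finally show ?thesis unfolding factorization .
qed

definition random_coding_bound :: "real \<Rightarrow> real \<Rightarrow> real \<Rightarrow> real \<Rightarrow> nat \<Rightarrow> nat \<Rightarrow> real" where
  "random_coding_bound F \<delta> c \<rho> n m = 2 powr (\<rho> * (F * (1 - \<delta>) * real m - c * real n))
     * (\<delta> + (1 - \<delta>) * 2 powr (- (F * \<rho>))) ^ m"

lemma ex_random_coding_bound_less_one:
  assumes "0 < c"
  shows "\<exists>\<rho>. 0 < \<rho> \<and> \<rho> \<le> 1 \<and> random_coding_bound F \<delta> c \<rho> 1 1 < 1"
proof -
  define \<phi> where "\<phi> \<rho> = random_coding_bound F \<delta> c \<rho> 1 1" for \<rho>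
  have "(\<phi> has_real_derivative - (c * ln 2)) (at 0)"
    unfolding \<phi>_def random_coding_bound_def
    by (rule derivative_eq_intros refl | simp add: algebra_simps)+
  then obtain h where h: "h > 0" "\<And>x. 0 < x \<Longrightarrow> x < h \<Longrightarrow> \<phi> (0 + x) < \<phi> 0"
    using DERIV_neg_dec_right[of \<phi> "- (c * ln 2)" 0] assms by auto
  have "\<phi> (min 1 (h / 2)) < 1"
    using h(2)[of "min 1 (h / 2)"] h(1) by (auto simp: \<phi>_def random_coding_bound_def)
  then show ?thesis using h(1) unfolding \<phi>_def by (intro exI[of _ "min 1 (h / 2)"]) auto
qed

lemma ex_random_coding_bound_le_power:
  assumes \<delta>: "0 < \<delta>" "\<delta> < 1" and c: "0 < c"
  shows "\<exists>\<rho> r. 0 < \<rho> \<and> \<rho> \<le> 1 \<and> 0 \<le> r \<and> r < 1 \<and>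
    (\<forall>n. \<forall>m\<le>n. random_coding_bound F \<delta> c \<rho> n m \<le> r ^ n)"
proof -
  obtain \<rho> where \<rho>: "0 < \<rho>" "\<rho> \<le> 1" and less: "random_coding_bound F \<delta> c \<rho> 1 1 < 1"
    using ex_random_coding_bound_less_one[OF c] by blast
  define a where "a = 2 powr (\<rho> * (F * (1 - \<delta>))) * (\<delta> + (1 - \<delta>) * 2 powr (- (F * \<rho>)))"
  define b where "b = 2 powr (- (\<rho> * c))"
  have bound: "random_coding_bound F \<delta> c \<rho> n m = a ^ m * b ^ n" for n m
  proof -
    have "2 powr (\<rho> * (F * (1 - \<delta>) * real m - c * real n))
      = (2 powr (\<rho> * (F * (1 - \<delta>)))) ^ m * b ^ n"
      by (simp add: b_def powr_power flip: powr_add) (simp add: algebra_simps)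
    then show ?thesis by (simp add: random_coding_bound_def a_def power_mult_distrib)
  qed
  have "0 \<le> a" unfolding a_def using \<delta> by (intro mult_nonneg_nonneg add_nonneg_nonneg) auto
  have "b < 2 powr 0" unfolding b_def using \<rho> c by (intro powr_less_mono) auto
  moreover have "a * b < 1" using less by (simp add: bound)
  ultimately have "max 1 a * b < 1" by (simp add: max_def)
  moreover have "random_coding_bound F \<delta> c \<rho> n m \<le> (max 1 a * b) ^ n" if "m \<le> n" for n m
  proof -
    have "a ^ m \<le> max 1 a ^ m" using \<open>0 \<le> a\<close> by (intro power_mono) auto
    also have "\<dots> \<le> max 1 a ^ n" by (intro power_increasing that) auto
    finally show ?thesis by (simp add: bound b_def power_mult_distrib)
  qed
  moreover have "0 \<le> max 1 a * b" by (simp add: b_def)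
  ultimately show ?thesis using \<rho> by blast
qed

section \<open>Random coding for the broadcast channel\<close>

locale erasure_broadcast =
  fixes F Kw Ks D :: nat and dw ds :: real
  assumes F_pos: "1 \<le> F" and Ks_pos: "1 \<le> Ks"
    and ds_pos: "0 < ds" and ds_le_dw: "ds \<le> dw" and dw_less_1: "dw < 1"
begin

abbreviation K :: nat where "K \<equiv> Kw + Ks"

abbreviation \<delta> :: "nat \<Rightarrow> real" where "\<delta> \<equiv> erasure_prob Kw dw ds"

abbreviation capacity :: "real \<Rightarrow> real" where "capacity x \<equiv> real F * (1 - x)"

abbreviation weight :: "nat \<Rightarrow> (nat \<times> nat \<Rightarrow> bool) \<Rightarrow> real" where
  "weight \<equiv> erasure_weight Kw dw ds K"

definition codebooks :: "nat \<Rightarrow> 'u set \<Rightarrow> (nat \<times> 'u \<Rightarrow> bool list) set" where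
  "codebooks n U = {..<n} \<times> U \<rightarrow>\<^sub>E {xs. length xs = F}"

text \<open>A receiver whose ambiguity about a payload stays below its capacity by \<open>c\<close> bits per channel
  use of the whole block confuses it with probability at most \<open>r ^ n\<close>.\<close>

definition error_decay :: "real \<Rightarrow> real \<Rightarrow> bool" where
  "error_decay c r \<longleftrightarrow> 0 \<le> r \<and> r < 1 \<and> (\<forall>x\<in>{dw, ds}. \<exists>\<rho>. 0 < \<rho> \<and> \<rho> \<le> 1 \<and>
     (\<forall>n. \<forall>m\<le>n. random_coding_bound (real F) x c \<rho> n m \<le> r ^ n))"

lemma erasure_prob_bounds: "0 < \<delta> k" "\<delta> k < 1"
  using ds_pos ds_le_dw dw_less_1 by (auto simp: erasure_prob_def)

lemma capacity_pos: "x < 1 \<Longrightarrow> 0 < capacity x"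
  using F_pos by simp

lemma weight_nonneg: "0 \<le> weight n e"
  using ds_pos ds_le_dw dw_less_1 by (intro erasure_weight_nonneg) auto

lemma ex_error_decay:
  assumes "0 < c"
  shows "\<exists>r. error_decay c r"
proof -
  obtain \<rho>w rw where w: "0 < \<rho>w" "\<rho>w \<le> 1" "0 \<le> rw" "rw < 1"
    "\<forall>n. \<forall>m\<le>n. random_coding_bound (real F) dw c \<rho>w n m \<le> rw ^ n"
    using ex_random_coding_bound_le_power[of dw c F] assms ds_pos ds_le_dw dw_less_1 by auto
  obtain \<rho>s rs where s: "0 < \<rho>s" "\<rho>s \<le> 1" "0 \<le> rs" "rs < 1"
    "\<forall>n. \<forall>m\<le>n. random_coding_bound (real F) ds c \<rho>s n m \<le> rs ^ n"
    using ex_random_coding_bound_le_power[of ds c F] assms ds_pos ds_le_dw dw_less_1 by auto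
  have mono: "\<forall>n. \<forall>m\<le>n. f n m \<le> max rw rs ^ n"
    if "\<forall>n. \<forall>m\<le>n. f n m \<le> r ^ n" "0 \<le> r" "r \<le> max rw rs" for f :: "nat \<Rightarrow> nat \<Rightarrow> real" and r
    using that(1) power_mono[OF that(3,2)] by (blast intro: order_trans)
  have "error_decay c (max rw rs)"
    unfolding error_decay_def using w s mono[OF w(5)] mono[OF s(5)] by auto
  then show ?thesis ..
qed

lemma finite_codebooks: "finite U \<Longrightarrow> finite (codebooks n U)"
  unfolding codebooks_def using finite_lists_length_eq[of "UNIV :: bool set" F]
  by (intro finite_PiE) auto

lemma codebooks_nonempty: "codebooks n U \<noteq> {}"
proof -
  have "replicate F True \<in> {xs. length xs = F}" by simp
  then have "{xs :: bool list. length xs = F} \<noteq> {}" by blast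
  then show ?thesis by (simp only: codebooks_def PiE_eq_empty_iff) simp
qed

lemma card_confusable_codebooks_le:
  assumes "finite U" "T \<subseteq> {..<n}" "S \<subseteq> U" "u \<in> U" "0 < \<rho>" "\<rho> \<le> 1"
  shows "real (card {C \<in> codebooks n U. confusable C T S u})
    \<le> real (card (codebooks n U)) * (real (card S) powr \<rho> * (2 powr (- (real F * \<rho>))) ^ card T)"
proof -
  let ?X = "{xs :: bool list. length xs = F}"
  have X: "finite ?X" "card ?X = 2 ^ F"
    using finite_lists_length_eq[of "UNIV :: bool set" F]
      card_lists_length_eq[of "UNIV :: bool set" F] by simp_all
  then have "?X \<noteq> {}" by (metis card.empty power_not_zero zero_neq_numeral)
  have "(real (card S) / real (card ?X) ^ card T) powr \<rho>
    = real (card S) powr \<rho> * (2 powr (- (real F * \<rho>))) ^ card T"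
  proof -
    have "real (card ?X) ^ card T = 2 powr (real F * real (card T))"
      unfolding X(2) by (simp add: powr_realpow flip: of_nat_mult power_mult)
    then show ?thesis
      by (simp add: powr_divide powr_powr powr_power powr_minus_divide power_divide mult_ac)
  qed
  then show ?thesis
    using card_confusable_le_powr[OF finite_lessThan assms(1) X(1) \<open>?X \<noteq> {}\<close> assms(2-6)]
    by (simp add: codebooks_def)
qed

lemma sum_weight_confusable_le:
  assumes decay: "error_decay c r" and k: "k < K" and T: "T \<subseteq> {..<n}"
    and U: "finite U" "S \<subseteq> U" "u \<in> U"
    and card: "real (card S) \<le> 2 powr (capacity (\<delta> k) * real (card T) - c * real n)"
  shows "(\<Sum>C\<in>codebooks n U. \<Sum>e\<in>erasure_patterns K n.
      weight n e * of_bool (confusable C {\<tau>\<in>T. \<not> e (k, \<tau>)} S u))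
    \<le> real (card (codebooks n U)) * r ^ n"
proof -
  have "\<delta> k \<in> {dw, ds}" by (simp add: erasure_prob_def)
  then obtain \<rho> where \<rho>: "0 < \<rho>" "\<rho> \<le> 1" and bound: "\<And>m. m \<le> n \<Longrightarrow>
      random_coding_bound (real F) (\<delta> k) c \<rho> n m \<le> r ^ n"
    using decay unfolding error_decay_def by blast
  let ?Cs = "codebooks n U" and ?E = "erasure_patterns K n" and ?z = "2 powr (- (real F * \<rho>))"
  let ?received = "\<lambda>e. {\<tau>\<in>T. \<not> e (k, \<tau>)}"
  have "(\<Sum>C\<in>?Cs. \<Sum>e\<in>?E. weight n e * of_bool (confusable C (?received e) S u))
    = (\<Sum>e\<in>?E. weight n e * real (card {C \<in> ?Cs. confusable C (?received e) S u}))"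
    using finite_codebooks[OF U(1)]
    by (subst sum.swap) (simp add: Int_def flip: sum_distrib_left)
  also have "\<dots> \<le> (\<Sum>e\<in>?E. weight n e
      * (real (card ?Cs) * (real (card S) powr \<rho> * ?z ^ card (?received e))))"
    using T U \<rho> by (intro sum_mono mult_left_mono card_confusable_codebooks_le weight_nonneg) auto
  also have "\<dots> = real (card ?Cs)
      * (real (card S) powr \<rho> * (\<Sum>e\<in>?E. weight n e * ?z ^ card (?received e)))"
    by (simp add: sum_distrib_left mult_ac)
  also have "\<dots> = real (card ?Cs) * (real (card S) powr \<rho> * (\<delta> k + (1 - \<delta> k) * ?z) ^ card T)"
    by (simp only: erasure_weight_generating_function[OF k T])
  also have "\<dots> \<le> real (card ?Cs) * r ^ n"
  proof (rule mult_left_mono)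
    have "real (card S) powr \<rho> \<le> (2 powr (capacity (\<delta> k) * real (card T) - c * real n)) powr \<rho>"
      using card \<rho> by (intro powr_mono2) auto
    then have "real (card S) powr \<rho> * (\<delta> k + (1 - \<delta> k) * ?z) ^ card T
      \<le> random_coding_bound (real F) (\<delta> k) c \<rho> n (card T)"
      unfolding random_coding_bound_def using erasure_prob_bounds[of k]
      by (intro mult_right_mono zero_le_power add_nonneg_nonneg mult_nonneg_nonneg)
        (auto simp: powr_powr mult.commute)
    also have "\<dots> \<le> r ^ n" using card_mono[OF _ T] by (intro bound) simp
    finally show "real (card S) powr \<rho> * (\<delta> k + (1 - \<delta> k) * ?z) ^ card T \<le> r ^ n" .
  qed simp
  finally show ?thesis .
qed

end

definition slots_of :: "(nat \<Rightarrow> 'j) \<Rightarrow> nat \<Rightarrow> 'j \<Rightarrow> nat set" where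
  "slots_of slot n j = {\<tau>\<in>{..<n}. slot \<tau> = j}"

lemma finite_libraries: "finite (libraries D n R)"
  unfolding libraries_def by (auto intro!: finite_PiE)

text \<open>Slot \<open>\<tau>\<close> carries the random codeword symbol of the payload of job \<open>slot \<tau>\<close>, and receiver \<open>k\<close>
  listens to the jobs in \<open>wanted k\<close>. Its cache shrinks the set of payloads of a job that it has to
  tell apart, so only the size of that set has to stay below the capacity of receiver \<open>k\<close>.\<close>

locale payload_scheme = erasure_broadcast +
  fixes n :: nat and R :: real and cache :: "nat \<Rightarrow> (nat \<Rightarrow> nat) \<Rightarrow> nat" and d :: "nat \<Rightarrow> nat"
    and payload :: "'j \<Rightarrow> (nat \<Rightarrow> nat) \<Rightarrow> 'u" and jobs :: "'j set"
    and wanted :: "nat \<Rightarrow> 'j set" and slot :: "nat \<Rightarrow> 'j"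
  assumes libraries_nonempty: "libraries D n R \<noteq> {}"
    and finite_jobs: "finite jobs"
    and slot_in_jobs: "\<tau> < n \<Longrightarrow> slot \<tau> \<in> jobs"
    and wanted_subset_jobs: "k < K \<Longrightarrow> wanted k \<subseteq> jobs"
    and message_determined: "k < K \<Longrightarrow> W \<in> libraries D n R \<Longrightarrow> W' \<in> libraries D n R \<Longrightarrow>
      (k < Kw \<Longrightarrow> cache k W' = cache k W) \<Longrightarrow>
      (\<And>j. j \<in> wanted k \<Longrightarrow> payload j W' = payload j W) \<Longrightarrow> W' (d k) = W (d k)"
begin

abbreviation libs :: "(nat \<Rightarrow> nat) set" where "libs \<equiv> libraries D n R"

definition side_info :: "nat \<Rightarrow> (nat \<Rightarrow> nat) \<Rightarrow> nat" where
  "side_info k W = (if k < Kw then cache k W else 0)"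

definition candidates :: "nat \<Rightarrow> 'j \<Rightarrow> (nat \<Rightarrow> nat) \<Rightarrow> 'u set" where
  "candidates k j W = payload j ` {W' \<in> libs. side_info k W' = side_info k W}"

definition payloads :: "'u set" where
  "payloads = (\<Union>j\<in>jobs. payload j ` libs)"

definition encode :: "(nat \<times> 'u \<Rightarrow> bool list) \<Rightarrow> (nat \<Rightarrow> nat) \<Rightarrow> nat \<Rightarrow> bool list" where
  "encode C W \<tau> = C (\<tau>, payload (slot \<tau>) W)"

definition consistent ::
  "(nat \<times> 'u \<Rightarrow> bool list) \<Rightarrow> nat \<Rightarrow> (nat \<Rightarrow> bool list option) \<Rightarrow> nat \<Rightarrow> (nat \<Rightarrow> nat) \<Rightarrow> bool" where
  "consistent C k y v W \<longleftrightarrow> W \<in> libs \<and> side_info k W = v \<and>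
     (\<forall>\<tau><n. slot \<tau> \<in> wanted k \<longrightarrow> y \<tau> \<noteq> None \<longrightarrow> y \<tau> = Some (encode C W \<tau>))"

definition decode ::
  "(nat \<times> 'u \<Rightarrow> bool list) \<Rightarrow> nat \<Rightarrow> (nat \<Rightarrow> bool list option) \<Rightarrow> nat \<Rightarrow> nat" where
  "decode C k y v = (SOME W. consistent C k y v W) (d k)"

definition decoding_error ::
  "(nat \<times> 'u \<Rightarrow> bool list) \<Rightarrow> nat \<Rightarrow> (nat \<Rightarrow> nat) \<Rightarrow> (nat \<times> nat \<Rightarrow> bool) \<Rightarrow> bool" where
  "decoding_error C k W e \<longleftrightarrow>
     decode C k (channel_output n (encode C W) e k) (side_info k W) \<noteq> W (d k)"

definition codebook_error_prob :: "(nat \<times> 'u \<Rightarrow> bool list) \<Rightarrow> real" where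
  "codebook_error_prob C =
     error_prob Kw Ks dw ds D n R cache (\<lambda>_. encode C) (\<lambda>k _. decode C k) d"

definition confuses ::
  "(nat \<times> 'u \<Rightarrow> bool list) \<Rightarrow> (nat \<Rightarrow> nat) \<Rightarrow> (nat \<times> nat \<Rightarrow> bool) \<Rightarrow> nat \<times> 'j \<Rightarrow> bool" where
  "confuses C W e = (\<lambda>(k, j).
     confusable C {\<tau>\<in>slots_of slot n j. \<not> e (k, \<tau>)} (candidates k j W) (payload j W))"

lemma finite_payloads: "finite payloads"
  unfolding payloads_def using finite_jobs finite_libraries by auto

lemma finite_wanted: "finite (Sigma {..<K} wanted)"
  using wanted_subset_jobs finite_jobs by (intro finite_SigmaI) (auto intro: finite_subset)

lemma card_wanted_le: "card (Sigma {..<K} wanted) \<le> K * card jobs"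
proof -
  have "card (Sigma {..<K} wanted) \<le> card ({..<K} \<times> jobs)"
    using wanted_subset_jobs finite_jobs by (intro card_mono) auto
  then show ?thesis by (simp add: card_cartesian_product)
qed

lemma decoding_error_imp_confuses:
  assumes W: "W \<in> libs" and k: "k < K" and error: "decoding_error C k W e"
  shows "\<exists>j\<in>wanted k. confuses C W e (k, j)"
proof -
  let ?consistent = "consistent C k (channel_output n (encode C W) e k) (side_info k W)"
  define W' where "W' = (SOME W'. ?consistent W')"
  have "?consistent W" using W by (simp add: consistent_def channel_output_def)
  then have W': "?consistent W'" unfolding W'_def by (rule someI[of ?consistent])
  then have lib: "W' \<in> libs" "side_info k W' = side_info k W" by (auto simp: consistent_def)
  have "W' (d k) \<noteq> W (d k)" using error unfolding decoding_error_def decode_def W'_def .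
  moreover have "cache k W' = cache k W" if "k < Kw" using lib(2) that by (simp add: side_info_def)
  ultimately obtain j where j: "j \<in> wanted k" "payload j W' \<noteq> payload j W"
    using message_determined[OF k W lib(1)] by blast
  have "C (\<tau>, payload j W') = C (\<tau>, payload j W)" if "\<tau> \<in> slots_of slot n j" "\<not> e (k, \<tau>)" for \<tau>
    using W' that j unfolding consistent_def channel_output_def slots_of_def encode_def by auto
  moreover have "payload j W' \<in> candidates k j W" using lib by (auto simp: candidates_def)
  ultimately show ?thesis using j by (auto simp: confuses_def confusable_def)
qed

lemma decoding_error_indicator_le:
  assumes "W \<in> libs"
  shows "of_bool (\<exists>k<K. decoding_error C k W e)
    \<le> (\<Sum>x\<in>Sigma {..<K} wanted. of_bool (confuses C W e x) :: real)"
proof (cases "\<exists>k<K. decoding_error C k W e")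
  case True
  then obtain x where x: "x \<in> Sigma {..<K} wanted" "confuses C W e x"
    using decoding_error_imp_confuses[OF assms] by blast
  then have "1 \<le> (\<Sum>x\<in>Sigma {..<K} wanted. of_bool (confuses C W e x) :: real)"
    using finite_wanted
      member_le_sum[of x "Sigma {..<K} wanted" "\<lambda>x. of_bool (confuses C W e x) :: real"]
    by simp
  then show ?thesis by simp
next
  case False
  show ?thesis unfolding of_bool_def if_not_P[OF False] by (rule sum_nonneg) simp
qed

lemma codebook_error_prob_eq_average:
  "codebook_error_prob C
    = (\<Sum>W\<in>libs. \<Sum>e\<in>erasure_patterns K n. weight n e * of_bool (\<exists>k<K. decoding_error C k W e))
      / real (card libs)"
  unfolding codebook_error_prob_def error_prob_def decoding_error_def side_info_def of_bool_def
    sum_divide_distrib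
  by simp

context
  fixes c r :: real
  assumes decay: "error_decay c r"
    and few_candidates: "\<And>k W j. k < K \<Longrightarrow> W \<in> libs \<Longrightarrow> j \<in> wanted k \<Longrightarrow>
      real (card (candidates k j W))
        \<le> 2 powr (capacity (\<delta> k) * real (card (slots_of slot n j)) - c * real n)"
begin

lemma sum_decoding_error_le:
  assumes W: "W \<in> libs"
  shows "(\<Sum>C\<in>codebooks n payloads. \<Sum>e\<in>erasure_patterns K n.
      weight n e * of_bool (\<exists>k<K. decoding_error C k W e))
    \<le> real (card (codebooks n payloads)) * (real (K * card jobs) * r ^ n)"
proof -
  let ?Cs = "codebooks n payloads" and ?E = "erasure_patterns K n" and ?Q = "Sigma {..<K} wanted"
  have confuses: "(\<Sum>C\<in>?Cs. \<Sum>e\<in>?E. weight n e * of_bool (confuses C W e x))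
      \<le> real (card ?Cs) * r ^ n"
    if x: "x \<in> ?Q" for x
  proof -
    obtain k j where x_eq: "x = (k, j)" and k: "k < K" and j: "j \<in> wanted k" using x by auto
    have "candidates k j W \<subseteq> payloads" "payload j W \<in> payloads"
      using W j wanted_subset_jobs[OF k] by (auto simp: payloads_def candidates_def)
    then show ?thesis unfolding x_eq confuses_def prod.case
      using few_candidates[OF k W j]
      by (intro sum_weight_confusable_le[OF decay k _ finite_payloads]) (auto simp: slots_of_def)
  qed
  have "(\<Sum>C\<in>?Cs. \<Sum>e\<in>?E. weight n e * of_bool (\<exists>k<K. decoding_error C k W e))
    \<le> (\<Sum>C\<in>?Cs. \<Sum>e\<in>?E. weight n e * (\<Sum>x\<in>?Q. of_bool (confuses C W e x)))"
    by (intro sum_mono mult_left_mono decoding_error_indicator_le[OF W] weight_nonneg)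
  also have "\<dots> = (\<Sum>C\<in>?Cs. \<Sum>x\<in>?Q. \<Sum>e\<in>?E. weight n e * of_bool (confuses C W e x))"
    unfolding sum_distrib_left by (intro sum.cong[OF refl] sum.swap)
  also have "\<dots> = (\<Sum>x\<in>?Q. \<Sum>C\<in>?Cs. \<Sum>e\<in>?E. weight n e * of_bool (confuses C W e x))"
    by (rule sum.swap)
  also have "\<dots> \<le> real (card ?Q) * (real (card ?Cs) * r ^ n)"
    using sum_mono[OF confuses] by simp
  also have "\<dots> \<le> real (K * card jobs) * (real (card ?Cs) * r ^ n)"
    using card_wanted_le decay by (intro mult_right_mono of_nat_mono) (auto simp: error_decay_def)
  finally show ?thesis by (simp only: mult_ac)
qed

lemma ex_good_codebook:
  "\<exists>C\<in>codebooks n payloads. codebook_error_prob C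
    \<le> real (K * card jobs) * r ^ n"
proof (rule ccontr)
  let ?Cs = "codebooks n payloads" and ?b = "real (K * card jobs) * r ^ n"
  assume "\<not> (\<exists>C\<in>?Cs. codebook_error_prob C \<le> ?b)"
  then have "(\<Sum>C\<in>?Cs. ?b) < (\<Sum>C\<in>?Cs. codebook_error_prob C)"
    using finite_codebooks[OF finite_payloads] codebooks_nonempty by (intro sum_strict_mono) auto
  moreover have "(\<Sum>C\<in>?Cs. codebook_error_prob C) = (\<Sum>W\<in>libs. \<Sum>C\<in>?Cs. \<Sum>e\<in>erasure_patterns K n.
      weight n e * of_bool (\<exists>k<K. decoding_error C k W e)) / real (card libs)"
    unfolding codebook_error_prob_eq_average by (subst sum.swap) (simp only: sum_divide_distrib)
  moreover have "\<dots> \<le> (\<Sum>W\<in>libs. real (card ?Cs) * ?b) / real (card libs)"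
    by (intro divide_right_mono sum_mono sum_decoding_error_le) auto
  moreover have "\<dots> = (\<Sum>C\<in>?Cs. ?b)"
    using libraries_nonempty finite_libraries[of D n R] by simp
  ultimately show False by linarith
qed

lemma ex_payload_code:
  "\<exists>enc dec. (\<forall>W\<in>libs. \<forall>\<tau><n. length (enc W \<tau>) = F) \<and>
    error_prob Kw Ks dw ds D n R cache (\<lambda>_. enc) (\<lambda>k _. dec k) d \<le> real (K * card jobs) * r ^ n"
proof -
  obtain C where C: "C \<in> codebooks n payloads" and
    error: "codebook_error_prob C
      \<le> real (K * card jobs) * r ^ n"
    using ex_good_codebook by blast
  have "length (encode C W \<tau>) = F" if "W \<in> libs" "\<tau> < n" for W \<tau>
  proof -
    have "(\<tau>, payload (slot \<tau>) W) \<in> {..<n} \<times> payloads"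
      using that slot_in_jobs by (auto simp: payloads_def)
    from PiE_mem[OF C[unfolded codebooks_def] this] show ?thesis by (simp add: encode_def)
  qed
  then show ?thesis using error unfolding codebook_error_prob_def by blast
qed

end

end

section \<open>Coded caching with piggybacking\<close>

lemma ex_slot_assignment:
  fixes m :: "'j \<Rightarrow> nat"
  assumes "finite J" "J \<noteq> {}" "(\<Sum>j\<in>J. m j) \<le> n"
  shows "\<exists>slot. (\<forall>\<tau>. slot \<tau> \<in> J) \<and> (\<forall>j\<in>J. m j \<le> card (slots_of slot n j))"
  using assms
proof (induction J arbitrary: n rule: finite_ne_induct)
  case (singleton j)
  then show ?case by (intro exI[of _ "\<lambda>_. j"]) (auto simp: slots_of_def)
next
  case (insert i J)
  then have sum: "m i + (\<Sum>j\<in>J. m j) \<le> n" by simp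
  then have "sum m J \<le> n - m i" by simp
  from insert.IH[OF this] obtain slot where slot: "\<forall>\<tau>. slot \<tau> \<in> J"
    "\<forall>j\<in>J. m j \<le> card (slots_of slot (n - m i) j)"
    by blast
  let ?slot = "\<lambda>\<tau>. if \<tau> < n - m i then slot \<tau> else i"
  have "m i = card {n - m i..<n}" using sum by simp
  also have "\<dots> \<le> card (slots_of ?slot n i)" by (rule card_mono) (auto simp: slots_of_def)
  finally have "m i \<le> card (slots_of ?slot n i)" .
  moreover have "m j \<le> card (slots_of ?slot n j)" if "j \<in> J" for j
  proof -
    have "m j \<le> card (slots_of slot (n - m i) j)" using slot that by blast
    also have "\<dots> \<le> card (slots_of ?slot n j)" by (rule card_mono) (auto simp: slots_of_def)
    finally show ?thesis .
  qed
  ultimately show ?case using slot(1) by (intro exI[of _ ?slot]) auto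
qed

lemma ex_slot_assignment_fractions:
  fixes f :: "'j \<Rightarrow> real"
  assumes "finite J" "J \<noteq> {}" and f: "\<And>j. j \<in> J \<Longrightarrow> 0 \<le> f j" "(\<Sum>j\<in>J. f j) \<le> 1"
  shows "\<exists>slot. (\<forall>\<tau>. slot \<tau> \<in> J) \<and>
    (\<forall>j\<in>J. f j * real n - 1 \<le> real (card (slots_of slot n j)))"
proof -
  let ?m = "\<lambda>j. nat \<lfloor>f j * real n\<rfloor>"
  have "real (\<Sum>j\<in>J. ?m j) \<le> (\<Sum>j\<in>J. f j * real n)"
    unfolding of_nat_sum using f(1) by (intro sum_mono of_nat_floor) simp
  also have "\<dots> \<le> 1 * real n"
    unfolding sum_distrib_right[symmetric] using f(2) by (intro mult_right_mono) auto
  finally have "(\<Sum>j\<in>J. ?m j) \<le> n" by (simp only: mult_1 of_nat_le_iff)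
  from ex_slot_assignment[OF assms(1,2) this] obtain slot where slot: "\<forall>\<tau>. slot \<tau> \<in> J"
    "\<forall>j\<in>J. ?m j \<le> card (slots_of slot n j)" by blast
  have "f j * real n - 1 \<le> real (card (slots_of slot n j))" if "j \<in> J" for j
    using slot(2) that by (force simp: nat_le_iff floor_le_iff)
  then show ?thesis using slot(1) by blast
qed

lemma msg_size_pos:
  assumes "0 \<le> R"
  shows "0 < msg_size n R"
proof -
  have "1 \<le> 2 powr (real n * R)" using assms by (intro ge_one_powr_ge_zero) auto
  then show ?thesis unfolding msg_size_def by linarith
qed

context erasure_broadcast
begin

definition admits_code :: "nat \<Rightarrow> real \<Rightarrow> real \<Rightarrow> real \<Rightarrow> bool" where
  "admits_code n R M \<epsilon> \<longleftrightarrow> (\<exists>cache enc dec. valid_code F Kw Ks D n R M cache enc \<and>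
     (\<forall>d. valid_demand K D d \<longrightarrow> error_prob Kw Ks dw ds D n R cache enc dec d \<le> \<epsilon>))"

abbreviation cache_sets :: "nat set set" where "cache_sets \<equiv> Pow {..<Kw}"

abbreviation cache_sets_with :: "nat \<Rightarrow> nat set set" where
  "cache_sets_with i \<equiv> {S\<in>Pow {..<Kw}. i \<in> S}"

text \<open>The modulus 1 makes the coded-caching sum for the empty set carry no information.\<close>

definition sum_modulus :: "(nat \<Rightarrow> nat) \<Rightarrow> nat set \<Rightarrow> nat" where
  "sum_modulus q S = (if S = {} then 1 else q (card S - 1))"

definition split_messages :: "(nat \<Rightarrow> nat) \<Rightarrow> (nat set \<Rightarrow> nat) set" where
  "split_messages q = (\<Pi>\<^sub>E S\<in>cache_sets. {..<q (card S)})"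

definition cache_contents :: "(nat \<Rightarrow> nat) \<Rightarrow> nat \<Rightarrow> (nat \<times> nat set \<Rightarrow> nat) set" where
  "cache_contents q i = (\<Pi>\<^sub>E x\<in>{..<D} \<times> cache_sets_with i. {..<q (card (snd x))})"

lemma finite_split_messages: "finite (split_messages q)"
  unfolding split_messages_def by (intro finite_PiE) auto

lemma card_split_messages: "card (split_messages q) = (\<Prod>S\<in>cache_sets. q (card S))"
  unfolding split_messages_def by (simp add: card_PiE)

lemma finite_cache_contents: "finite (cache_contents q i)"
  unfolding cache_contents_def by (intro finite_PiE) auto

lemma card_cache_contents:
  "card (cache_contents q i) = (\<Prod>S\<in>cache_sets_with i. q (card S)) ^ D"
proof -
  have "card (cache_contents q i) = (\<Prod>x\<in>{..<D} \<times> cache_sets_with i. q (card (snd x)))"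
    unfolding cache_contents_def by (simp add: card_PiE)
  also have "\<dots> = (\<Prod>j<D. \<Prod>S\<in>cache_sets_with i. q (card S))"
    unfolding prod.cartesian_product case_prod_unfold ..
  finally show ?thesis by simp
qed

end

text \<open>A message consists of one piece in \<open>{..<q (card S)}\<close> for every set \<open>S\<close> of weak receivers,
  and exactly the members of \<open>S\<close> cache it. There is one job per \<open>S\<close>: its payload is the
  coded-caching sum for the members of \<open>S\<close> together with the pieces with index \<open>S\<close> demanded by the
  strong receivers, which piggyback for free because the members of \<open>S\<close> have them cached.\<close>

locale coded_caching_scheme = erasure_broadcast +
  fixes n :: nat and R M :: real and q :: "nat \<Rightarrow> nat"
    and split :: "nat \<Rightarrow> nat set \<Rightarrow> nat" and label :: "nat \<Rightarrow> (nat \<times> nat set \<Rightarrow> nat) \<Rightarrow> nat"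
  assumes rate_nonneg: "0 \<le> R" and q_pos: "0 < q s"
    and split_mem: "split ` {1..msg_size n R} \<subseteq> split_messages q"
    and split_inj: "inj_on split {1..msg_size n R}"
    and label_mem: "i < Kw \<Longrightarrow> label i ` cache_contents q i \<subseteq> {1..msg_size n M}"
    and label_inj: "i < Kw \<Longrightarrow> inj_on (label i) (cache_contents q i)"
begin

abbreviation libs :: "(nat \<Rightarrow> nat) set" where "libs \<equiv> libraries D n R"

definition piece :: "(nat \<Rightarrow> nat) \<Rightarrow> nat \<Rightarrow> nat set \<Rightarrow> nat" where
  "piece W j S = split (W j) S"

definition content :: "nat \<Rightarrow> (nat \<Rightarrow> nat) \<Rightarrow> nat \<times> nat set \<Rightarrow> nat" where
  "content i W = (\<lambda>(j, S)\<in>{..<D} \<times> cache_sets_with i. piece W j S)"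

definition cache :: "nat \<Rightarrow> (nat \<Rightarrow> nat) \<Rightarrow> nat" where
  "cache i W = label i (content i W)"

definition coded_sum :: "(nat \<Rightarrow> nat) \<Rightarrow> nat set \<Rightarrow> (nat \<Rightarrow> nat) \<Rightarrow> nat" where
  "coded_sum d S W = (\<Sum>i\<in>S. piece W (d i) (S - {i})) mod sum_modulus q S"

definition piggyback :: "(nat \<Rightarrow> nat) \<Rightarrow> nat set \<Rightarrow> (nat \<Rightarrow> nat) \<Rightarrow> nat \<Rightarrow> nat" where
  "piggyback d S W = (\<lambda>k\<in>{Kw..<K}. piece W (d k) S)"

definition payload :: "(nat \<Rightarrow> nat) \<Rightarrow> nat set \<Rightarrow> (nat \<Rightarrow> nat) \<Rightarrow> nat \<times> (nat \<Rightarrow> nat)" where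
  "payload d S W = (coded_sum d S W, piggyback d S W)"

definition wanted :: "nat \<Rightarrow> nat set set" where
  "wanted k = (if k < Kw then cache_sets_with k else cache_sets)"

lemma message_mem: "W \<in> libs \<Longrightarrow> j < D \<Longrightarrow> W j \<in> {1..msg_size n R}"
  unfolding libraries_def by (erule PiE_mem) simp

lemma libraries_nonempty: "libs \<noteq> {}"
  using msg_size_pos[OF rate_nonneg, of n] by (auto simp: libraries_def PiE_eq_empty_iff)

lemma split_message_mem: "W \<in> libs \<Longrightarrow> j < D \<Longrightarrow> split (W j) \<in> split_messages q"
  using split_mem message_mem by blast

lemma piece_less:
  assumes "W \<in> libs" "j < D" "S \<in> cache_sets"
  shows "piece W j S < q (card S)"
  using PiE_mem[OF split_message_mem[OF assms(1,2), unfolded split_messages_def] assms(3)]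
  by (simp add: piece_def)

lemma message_eqI:
  assumes W: "W \<in> libs" "W' \<in> libs" and "j < D"
    and pieces: "\<And>S. S \<in> cache_sets \<Longrightarrow> piece W' j S = piece W j S"
  shows "W' j = W j"
proof -
  have "split (W' j) = split (W j)"
  proof (rule PiE_ext)
    show "split (W' j) \<in> (\<Pi>\<^sub>E S\<in>cache_sets. {..<q (card S)})"
      "split (W j) \<in> (\<Pi>\<^sub>E S\<in>cache_sets. {..<q (card S)})"
      using split_message_mem W \<open>j < D\<close> unfolding split_messages_def by blast+
  qed (use pieces in \<open>simp add: piece_def\<close>)
  then show ?thesis using inj_onD[OF split_inj] message_mem W \<open>j < D\<close> by blast
qed

lemma content_mem: "W \<in> libs \<Longrightarrow> content i W \<in> cache_contents q i"
  unfolding content_def cache_contents_def using piece_less by auto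

lemma cache_mem: "i < Kw \<Longrightarrow> W \<in> libs \<Longrightarrow> cache i W \<in> {1..msg_size n M}"
  unfolding cache_def using label_mem content_mem by blast

lemma cached_piece_eq:
  assumes "k < Kw" "W \<in> libs" "W' \<in> libs" "cache k W' = cache k W"
    and "j < D" "S \<in> cache_sets_with k"
  shows "piece W' j S = piece W j S"
proof -
  have "content k W' = content k W"
    using assms(4) unfolding cache_def
    by (rule inj_onD[OF label_inj[OF assms(1)] _ content_mem[OF assms(3)] content_mem[OF assms(2)]])
  then have "content k W' (j, S) = content k W (j, S)" by simp
  then show ?thesis using assms by (simp add: content_def)
qed

lemma coded_sum_reveals_piece:
  assumes d: "valid_demand K D d" and k: "k < Kw" and W: "W \<in> libs" "W' \<in> libs"
    and cache: "cache k W' = cache k W" and S: "S \<in> cache_sets" "k \<notin> S"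
    and sum: "coded_sum d (insert k S) W' = coded_sum d (insert k S) W"
  shows "piece W' (d k) S = piece W (d k) S"
proof -
  let ?T = "insert k S"
  have demand: "d i < D" if "i < Kw" for i using d that by (simp add: valid_demand_def)
  have "finite S" using S(1) by (auto intro: finite_subset)
  then have modulus: "sum_modulus q ?T = q (card S)" using S(2) by (simp add: sum_modulus_def)
  have T_sum: "(\<Sum>i\<in>?T. piece Z (d i) (?T - {i}))
    = piece Z (d k) S + (\<Sum>i\<in>S. piece Z (d i) (?T - {i}))"
    for Z
    using \<open>finite S\<close> S(2) by simp
  have "(\<Sum>i\<in>S. piece W' (d i) (?T - {i})) = (\<Sum>i\<in>S. piece W (d i) (?T - {i}))"
    using S k by (intro sum.cong cached_piece_eq[OF k W cache] demand) auto
  then have "[piece W' (d k) S = piece W (d k) S] (mod q (card S))"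
    using sum unfolding coded_sum_def modulus T_sum cong_def[symmetric]
    by (simp add: cong_add_rcancel_nat)
  then show ?thesis
    by (rule cong_less_modulus_unique_nat) (use W S(1) demand[OF k] in \<open>simp_all add: piece_less\<close>)
qed

lemma wanted_payloads_determine_message:
  assumes d: "valid_demand K D d" and k: "k < K" and W: "W \<in> libs" "W' \<in> libs"
    and cache: "k < Kw \<Longrightarrow> cache k W' = cache k W"
    and payloads: "\<And>S. S \<in> wanted k \<Longrightarrow> payload d S W' = payload d S W"
  shows "W' (d k) = W (d k)"
proof (rule message_eqI[OF W])
  show demand: "d k < D" using d k by (simp add: valid_demand_def)
  fix S assume S: "S \<in> cache_sets"
  consider "\<not> k < Kw" | "k < Kw" "k \<in> S" | "k < Kw" "k \<notin> S" by blast
  then show "piece W' (d k) S = piece W (d k) S"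
  proof cases
    case 1
    then have "piggyback d S W' k = piggyback d S W k"
      using payloads[of S] S by (simp add: wanted_def payload_def)
    then show ?thesis using 1 k by (simp add: piggyback_def)
  next
    case 2
    then show ?thesis using cached_piece_eq[OF 2(1) W cache demand] S by simp
  next
    case 3
    then show ?thesis
      using payloads[of "insert k S"] S
      by (intro coded_sum_reveals_piece[OF d _ W cache]) (auto simp: wanted_def payload_def)
  qed
qed

lemma sum_modulus_pos: "0 < sum_modulus q S"
  using q_pos by (simp add: sum_modulus_def)

lemma card_weak_candidates_le:
  assumes d: "valid_demand K D d" and k: "k < Kw" and W: "W \<in> libs" and S: "S \<in> cache_sets_with k"
  shows "card (payload d S ` {W' \<in> libs. cache k W' = cache k W}) \<le> sum_modulus q S"
proof -
  have "payload d S W' \<in> {..<sum_modulus q S} \<times> {piggyback d S W}"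
    if W': "W' \<in> libs" "cache k W' = cache k W" for W'
  proof -
    have "piggyback d S W' = piggyback d S W"
      unfolding piggyback_def using d
      by (intro restrict_ext cached_piece_eq[OF k W W' _ S]) (simp add: valid_demand_def)
    then show ?thesis using sum_modulus_pos by (simp add: payload_def coded_sum_def)
  qed
  then have "payload d S ` {W' \<in> libs. cache k W' = cache k W}
    \<subseteq> {..<sum_modulus q S} \<times> {piggyback d S W}"
    by blast
  then have "card (payload d S ` {W' \<in> libs. cache k W' = cache k W})
    \<le> card ({..<sum_modulus q S} \<times> {piggyback d S W})"
    by (intro card_mono) auto
  then show ?thesis by simp
qed

lemma card_payloads_le:
  assumes d: "valid_demand K D d" and S: "S \<in> cache_sets"
  shows "card (payload d S ` libs) \<le> sum_modulus q S * q (card S) ^ Ks"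
proof -
  let ?pieces = "{Kw..<K} \<rightarrow>\<^sub>E {..<q (card S)}"
  have "payload d S ` libs \<subseteq> {..<sum_modulus q S} \<times> ?pieces"
    using sum_modulus_pos d S
    by (auto simp: payload_def coded_sum_def piggyback_def valid_demand_def intro!: piece_less)
  then have "card (payload d S ` libs) \<le> card ({..<sum_modulus q S} \<times> ?pieces)"
    by (intro card_mono finite_cartesian_product finite_PiE) auto
  then show ?thesis by (simp add: card_cartesian_product card_PiE)
qed

lemma ex_code_for_demand:
  assumes d: "valid_demand K D d" and decay: "error_decay c r"
    and slot: "\<And>\<tau>. slot \<tau> \<in> cache_sets"
    and weak: "\<And>S. S \<in> cache_sets \<Longrightarrow>
      real (sum_modulus q S) \<le> 2 powr (capacity dw * real (card (slots_of slot n S)) - c * real n)"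
    and strong: "\<And>S. S \<in> cache_sets \<Longrightarrow> real (sum_modulus q S * q (card S) ^ Ks)
      \<le> 2 powr (capacity ds * real (card (slots_of slot n S)) - c * real n)"
  shows "\<exists>enc dec. (\<forall>W\<in>libs. \<forall>\<tau><n. length (enc W \<tau>) = F) \<and>
    error_prob Kw Ks dw ds D n R cache (\<lambda>_. enc) (\<lambda>k _. dec k) d \<le> real (K * 2 ^ Kw) * r ^ n"
proof -
  interpret delivery: payload_scheme F Kw Ks D dw ds n R cache d "payload d" cache_sets wanted slot
  proof
    show "W' (d k) = W (d k)"
      if "k < K" "W \<in> libs" "W' \<in> libs" "k < Kw \<Longrightarrow> cache k W' = cache k W"
        "\<And>S. S \<in> wanted k \<Longrightarrow> payload d S W' = payload d S W" for k W W'
      using that by (rule wanted_payloads_determine_message[OF d])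
  qed (use slot libraries_nonempty in \<open>auto simp: wanted_def\<close>)
  have few_candidates: "real (card (delivery.candidates k S W))
      \<le> 2 powr (capacity (\<delta> k) * real (card (slots_of slot n S)) - c * real n)"
    if k: "k < K" and W: "W \<in> libs" and S: "S \<in> wanted k" for k W S
  proof (cases "k < Kw")
    case True
    have "real (card (delivery.candidates k S W)) \<le> real (sum_modulus q S)"
      using card_weak_candidates_le[OF d True W] S True
      by (simp add: wanted_def delivery.candidates_def delivery.side_info_def)
    also have "\<dots> \<le> 2 powr (capacity (\<delta> k) * real (card (slots_of slot n S)) - c * real n)"
      using weak[of S] S True by (auto simp: wanted_def slots_of_def erasure_prob_def)
    finally show ?thesis .
  next
    case False
    have "real (card (delivery.candidates k S W)) \<le> real (sum_modulus q S * q (card S) ^ Ks)"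
      using card_payloads_le[OF d] S False
      by (simp add: wanted_def delivery.candidates_def delivery.side_info_def del: of_nat_mult)
    also have "\<dots> \<le> 2 powr (capacity (\<delta> k) * real (card (slots_of slot n S)) - c * real n)"
      using strong[of S] S False by (simp add: wanted_def slots_of_def erasure_prob_def)
    finally show ?thesis .
  qed
  show ?thesis using delivery.ex_payload_code[OF decay few_candidates] by (simp add: card_Pow)
qed

end

lemma (in erasure_broadcast) coded_caching_code:
  assumes R: "0 \<le> R" and q: "\<And>s. 0 < q s"
    and msg: "msg_size n R \<le> (\<Prod>S\<in>cache_sets. q (card S))"
    and memory: "\<And>i. i < Kw \<Longrightarrow> (\<Prod>S\<in>cache_sets_with i. q (card S)) ^ D \<le> msg_size n M"
    and decay: "error_decay c r" and slot: "\<And>\<tau>. slot \<tau> \<in> cache_sets"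
    and weak: "\<And>S. S \<in> cache_sets \<Longrightarrow> real (sum_modulus q S)
      \<le> 2 powr (capacity dw * real (card (slots_of slot n S)) - c * real n)"
    and strong: "\<And>S. S \<in> cache_sets \<Longrightarrow> real (sum_modulus q S * q (card S) ^ Ks)
      \<le> 2 powr (capacity ds * real (card (slots_of slot n S)) - c * real n)"
  shows "admits_code n R M (real (K * 2 ^ Kw) * r ^ n)"
proof -
  obtain split where split: "split ` {1..msg_size n R} \<subseteq> split_messages q"
    "inj_on split {1..msg_size n R}"
    using card_le_inj[of "{1..msg_size n R}" "split_messages q"] msg finite_split_messages
    by (auto simp: card_split_messages)
  have "\<exists>f. f ` cache_contents q i \<subseteq> {1..msg_size n M} \<and> inj_on f (cache_contents q i)"
    if "i < Kw" for i
    using memory[OF that] finite_cache_contents by (intro card_le_inj) (auto simp: card_cache_contents)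
  then obtain label where label: "\<And>i. i < Kw \<Longrightarrow> label i ` cache_contents q i \<subseteq> {1..msg_size n M}"
    "\<And>i. i < Kw \<Longrightarrow> inj_on (label i) (cache_contents q i)" by metis
  interpret coded_caching_scheme F Kw Ks D dw ds n R M q split label
    using R q split label by unfold_locales
  have "\<exists>enc dec. (\<forall>W\<in>libs. \<forall>\<tau><n. length (enc W \<tau>) = F) \<and>
    error_prob Kw Ks dw ds D n R cache (\<lambda>_. enc) (\<lambda>k _. dec k) d \<le> real (K * 2 ^ Kw) * r ^ n"
    if "valid_demand K D d" for d
    using that decay slot weak strong by (rule ex_code_for_demand)
  then obtain enc dec where
    length: "\<And>d W \<tau>. valid_demand K D d \<Longrightarrow> W \<in> libs \<Longrightarrow> \<tau> < n \<Longrightarrow> length (enc d W \<tau>) = F" and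
    error: "\<And>d. valid_demand K D d \<Longrightarrow>
      error_prob Kw Ks dw ds D n R cache (\<lambda>_. enc d) (\<lambda>k _. dec d k) d \<le> real (K * 2 ^ Kw) * r ^ n"
    by metis
  have "valid_code F Kw Ks D n R M cache enc"
    using cache_mem length unfolding valid_code_def msg_size_def by blast
  moreover have "error_prob Kw Ks dw ds D n R cache enc (\<lambda>k d. dec d k) d
      \<le> real (K * 2 ^ Kw) * r ^ n"
    if "valid_demand K D d" for d
    using error[OF that] by (simp only: error_prob_def)
  ultimately show ?thesis unfolding admits_code_def by blast
qed

section \<open>Rate allocations\<close>

lemma msg_size_le: "real (msg_size n R) \<le> 2 powr (real n * R)"
  unfolding msg_size_def by (rule of_nat_floor) simp

lemma two_powr_minus_one_le_msg_size:
  assumes "0 \<le> R"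
  shows "2 powr (real n * R - 1) \<le> real (msg_size n R)"
proof -
  have "2 powr (real n * R) < real (msg_size n R) + 1" unfolding msg_size_def by linarith
  also have "\<dots> \<le> 2 * real (msg_size n R)" using msg_size_pos[OF assms, of n] by simp
  finally show ?thesis by (simp add: powr_diff)
qed

lemma msg_size_le_prod:
  assumes "finite A" and f: "\<And>x. x \<in> A \<Longrightarrow> 0 \<le> f x"
    and R: "real n * R + real (card A) \<le> real n * (\<Sum>x\<in>A. f x)"
  shows "msg_size n R \<le> (\<Prod>x\<in>A. msg_size n (f x))"
proof -
  have "real (msg_size n R) \<le> 2 powr (real n * R)" by (rule msg_size_le)
  also have "\<dots> \<le> 2 powr (\<Sum>x\<in>A. real n * f x - 1)"
    using R by (intro powr_mono) (simp_all add: sum_subtractf flip: sum_distrib_left)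
  also have "\<dots> = (\<Prod>x\<in>A. 2 powr (real n * f x - 1))"
    using \<open>finite A\<close> by (simp add: powr_sum)
  also have "\<dots> \<le> (\<Prod>x\<in>A. real (msg_size n (f x)))"
    using f by (intro prod_mono conjI two_powr_minus_one_le_msg_size) auto
  finally show ?thesis by (simp flip: of_nat_prod)
qed

lemma prod_msg_size_power_le:
  assumes "finite A" and M: "real D * (\<Sum>x\<in>A. f x) \<le> M"
  shows "(\<Prod>x\<in>A. msg_size n (f x)) ^ D \<le> msg_size n M"
proof -
  have "real ((\<Prod>x\<in>A. msg_size n (f x)) ^ D) \<le> (\<Prod>x\<in>A. 2 powr (real n * f x)) ^ D"
    unfolding of_nat_power of_nat_prod
    by (intro power_mono prod_mono prod_nonneg) (auto intro: msg_size_le)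
  also have "\<dots> = 2 powr (real n * (real D * (\<Sum>x\<in>A. f x)))"
    using \<open>finite A\<close> by (simp add: powr_power mult_ac sum_distrib_left flip: powr_sum)
  also have "\<dots> \<le> 2 powr (real n * M)" using M by (intro powr_mono mult_left_mono) auto
  finally show ?thesis unfolding msg_size_def by (rule le_nat_floor)
qed

lemma eventually_le_mult_real:
  fixes b c :: real
  assumes "0 < c"
  shows "\<forall>\<^sub>F n in sequentially. b \<le> c * real n"
proof -
  have "filterlim (\<lambda>n. c * real n) at_top sequentially"
    using filterlim_tendsto_pos_mult_at_top[OF tendsto_const assms filterlim_real_sequentially] .
  then show ?thesis by (simp add: filterlim_at_top)
qed

context erasure_broadcast
begin

lemma admits_code_mono: "admits_code n R M \<epsilon> \<Longrightarrow> \<epsilon> \<le> \<epsilon>' \<Longrightarrow> admits_code n R M \<epsilon>'"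
  unfolding admits_code_def by (meson order_trans)

lemma achievableI:
  assumes "0 \<le> R" and b: "b \<longlonglongrightarrow> 0" and codes: "\<forall>\<^sub>F n in sequentially. admits_code n R M (b n)"
  shows "achievable F Kw Ks dw ds D R M"
  unfolding achievable_def
proof (intro conjI allI impI)
  fix \<epsilon> :: real assume "0 < \<epsilon>"
  from codes order_tendstoD(2)[OF b this]
  have "\<forall>\<^sub>F n in sequentially. admits_code n R M \<epsilon>"
    by eventually_elim (rule admits_code_mono[OF _ less_imp_le])
  then show "\<exists>N. \<forall>n\<ge>N. \<exists>cache enc dec. valid_code F Kw Ks D n R M cache enc \<and>
    (\<forall>d. valid_demand K D d \<longrightarrow> error_prob Kw Ks dw ds D n R cache enc dec d \<le> \<epsilon>)"
    by (simp add: eventually_sequentially admits_code_def)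
qed (rule assms(1))

definition sum_rate :: "(nat \<Rightarrow> real) \<Rightarrow> nat set \<Rightarrow> real" where
  "sum_rate p S = (if S = {} then 0 else p (card S - 1))"

lemma sum_modulus_le: "real (sum_modulus (\<lambda>s. msg_size n (p s)) S) \<le> 2 powr (real n * sum_rate p S)"
  using msg_size_le by (simp add: sum_modulus_def sum_rate_def)

lemma code_of_piece_rates:
  assumes R: "0 \<le> R" and p: "\<And>s. 0 \<le> p s"
    and rate: "real n * R + 2 ^ Kw \<le> real n * (\<Sum>S\<in>cache_sets. p (card S))"
    and memory: "\<And>i. i < Kw \<Longrightarrow> real D * (\<Sum>S\<in>cache_sets_with i. p (card S)) \<le> M"
    and decay: "error_decay c r" and slot: "\<And>\<tau>. slot \<tau> \<in> cache_sets"
    and weak: "\<And>S. S \<in> cache_sets \<Longrightarrow>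
      real n * sum_rate p S \<le> capacity dw * real (card (slots_of slot n S)) - c * real n"
    and strong: "\<And>S. S \<in> cache_sets \<Longrightarrow> real n * (sum_rate p S + real Ks * p (card S))
      \<le> capacity ds * real (card (slots_of slot n S)) - c * real n"
  shows "admits_code n R M (real (K * 2 ^ Kw) * r ^ n)"
proof (rule coded_caching_code[OF R _ _ _ decay slot])
  let ?q = "\<lambda>s. msg_size n (p s)"
  show "0 < ?q s" for s using p by (rule msg_size_pos)
  show "msg_size n R \<le> (\<Prod>S\<in>cache_sets. ?q (card S))"
    using p rate by (intro msg_size_le_prod) (auto simp: card_Pow)
  show "(\<Prod>S\<in>cache_sets_with i. ?q (card S)) ^ D \<le> msg_size n M" if "i < Kw" for i
    using memory[OF that] by (intro prod_msg_size_power_le) auto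
  fix S assume S: "S \<in> cache_sets"
  show "real (sum_modulus ?q S)
    \<le> 2 powr (capacity dw * real (card (slots_of slot n S)) - c * real n)"
    using weak[OF S] by (intro order_trans[OF sum_modulus_le] powr_mono) auto
  have "real (sum_modulus ?q S * ?q (card S) ^ Ks)
    \<le> 2 powr (real n * sum_rate p S) * (2 powr (real n * p (card S))) ^ Ks"
    unfolding of_nat_mult of_nat_power
    by (intro mult_mono sum_modulus_le power_mono msg_size_le) auto
  also have "\<dots> = 2 powr (real n * (sum_rate p S + real Ks * p (card S)))"
    by (simp add: powr_power powr_add[symmetric] algebra_simps)
  also have "\<dots> \<le> 2 powr (capacity ds * real (card (slots_of slot n S)) - c * real n)"
    using strong[OF S] by (intro powr_mono) auto
  finally show "real (sum_modulus ?q S * ?q (card S) ^ Ks)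
    \<le> 2 powr (capacity ds * real (card (slots_of slot n S)) - c * real n)" .
qed

text \<open>\<open>p s\<close> is the rate of each piece whose index set has size \<open>s\<close>, and \<open>T s\<close> is the fraction of
  channel uses spent on each job whose set has size \<open>s\<close>.\<close>

definition allocation :: "real \<Rightarrow> real \<Rightarrow> (nat \<Rightarrow> real) \<Rightarrow> (nat \<Rightarrow> real) \<Rightarrow> bool" where
  "allocation R M p T \<longleftrightarrow> (\<forall>s. 0 \<le> p s \<and> 0 \<le> T s) \<and>
     (\<Sum>S\<in>cache_sets. p (card S)) = R \<and>
     (\<forall>i<Kw. real D * (\<Sum>S\<in>cache_sets_with i. p (card S)) \<le> M) \<and>
     (\<Sum>S\<in>cache_sets. T (card S)) \<le> 1 \<and>
     (\<forall>s<Kw. p s \<le> T (Suc s) * capacity dw) \<and>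
     real Ks * p 0 \<le> T 0 * capacity ds \<and>
     (\<forall>s<Kw. p s + real Ks * p (Suc s) \<le> T (Suc s) * capacity ds)"

lemma
  assumes "allocation R M p T"
  shows allocation_nonneg: "0 \<le> p s" "0 \<le> T s"
    and allocation_rate: "(\<Sum>S\<in>cache_sets. p (card S)) = R"
    and allocation_memory: "i < Kw \<Longrightarrow> real D * (\<Sum>S\<in>cache_sets_with i. p (card S)) \<le> M"
    and allocation_time: "(\<Sum>S\<in>cache_sets. T (card S)) \<le> 1"
    and allocation_weak: "s < Kw \<Longrightarrow> p s \<le> T (Suc s) * capacity dw"
    and allocation_strong: "real Ks * p 0 \<le> T 0 * capacity ds"
      "s < Kw \<Longrightarrow> p s + real Ks * p (Suc s) \<le> T (Suc s) * capacity ds"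
  using assms by (simp_all add: allocation_def)

lemma
  assumes alloc: "allocation R M p T" and S: "S \<in> cache_sets"
  shows allocation_weak_job: "sum_rate p S \<le> T (card S) * capacity dw"
    and allocation_strong_job: "sum_rate p S + real Ks * p (card S) \<le> T (card S) * capacity ds"
proof -
  have "S = {} \<or> (\<exists>s<Kw. card S = Suc s)"
  proof (rule disjCI)
    assume "\<nexists>s. s < Kw \<and> card S = Suc s"
    moreover have "finite S" "card S \<le> Kw"
      using S card_mono[of "{..<Kw}" S] by (auto intro: finite_subset)
    ultimately show "S = {}" by (cases "card S") auto
  qed
  then show "sum_rate p S \<le> T (card S) * capacity dw"
    "sum_rate p S + real Ks * p (card S) \<le> T (card S) * capacity ds"
    using allocation_weak[OF alloc] allocation_strong[OF alloc]
      allocation_nonneg(2)[OF alloc, of 0] dw_less_1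
    by (auto simp: sum_rate_def)
qed

definition rate_region :: "(real \<times> real) set" where
  "rate_region = {(R, M). 0 < R \<and> (\<exists>p T. allocation R M p T)}"

text \<open>Scaling all rates by \<open>\<theta> < 1\<close> frees a fraction \<open>1 - \<theta>\<close> of the channel uses, which is spread
  evenly over the jobs; half of what a weak receiver gains on each job pays for rounding, the other
  half is the distance to capacity.\<close>

definition backoff :: "real \<Rightarrow> real" where
  "backoff \<theta> = capacity dw * ((1 - \<theta>) / 2 ^ Kw) / 2"

lemma backoff_pos: "\<theta> < 1 \<Longrightarrow> 0 < backoff \<theta>"
  unfolding backoff_def using capacity_pos[OF dw_less_1] by simp

lemma ex_slots_of_time_fractions:
  assumes T: "\<And>s. 0 \<le> T s" "(\<Sum>S\<in>cache_sets. T (card S)) \<le> 1" and \<theta>: "0 \<le> \<theta>" "\<theta> \<le> 1"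
  shows "\<exists>slot. (\<forall>\<tau>. slot \<tau> \<in> cache_sets) \<and> (\<forall>S\<in>cache_sets.
    (\<theta> * T (card S) + (1 - \<theta>) / 2 ^ Kw) * real n - 1 \<le> real (card (slots_of slot n S)))"
proof (rule ex_slot_assignment_fractions)
  have "(\<Sum>S\<in>cache_sets. \<theta> * T (card S) + (1 - \<theta>) / 2 ^ Kw)
    = \<theta> * (\<Sum>S\<in>cache_sets. T (card S)) + (1 - \<theta>)"
    by (simp add: sum.distrib card_Pow flip: sum_distrib_left)
  also have "\<dots> \<le> 1" using T(2) \<theta> by (simp add: mult_left_le)
  finally show "(\<Sum>S\<in>cache_sets. \<theta> * T (card S) + (1 - \<theta>) / 2 ^ Kw) \<le> 1" .
qed (use T(1) \<theta> in auto)

lemma backoff_absorbs_rounding: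
  assumes rate: "y \<le> t * capacity x" and x: "0 \<le> x" "x \<le> dw" and \<theta>: "0 \<le> \<theta>" "\<theta> \<le> 1"
    and N: "(\<theta> * t + (1 - \<theta>) / 2 ^ Kw) * real n - 1 \<le> N" and n: "real F \<le> backoff \<theta> * real n"
  shows "real n * (\<theta> * y) \<le> capacity x * N - backoff \<theta> * real n"
proof -
  let ?slack = "(1 - \<theta>) / 2 ^ Kw * real n"
  have "real n * (\<theta> * y) \<le> real n * (\<theta> * (t * capacity x))"
    using rate \<theta> by (intro mult_left_mono) auto
  moreover have "capacity x * ((\<theta> * t + (1 - \<theta>) / 2 ^ Kw) * real n - 1) \<le> capacity x * N"
    using N x dw_less_1 by (intro mult_left_mono) auto
  moreover have "capacity dw * ?slack \<le> capacity x * ?slack"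
    using x \<theta> by (intro mult_right_mono mult_left_mono) auto
  moreover have "capacity dw * ?slack = 2 * (backoff \<theta> * real n)" by (simp add: backoff_def)
  moreover have "capacity x \<le> real F" using x by (simp add: mult_left_le)
  ultimately show ?thesis using n by (simp add: algebra_simps)
qed

lemma code_of_allocation:
  assumes alloc: "allocation R M p T" and R': "0 \<le> R'" and \<theta>: "0 \<le> \<theta>" "\<theta> \<le> 1"
    and decay: "error_decay (backoff \<theta>) r"
    and n: "2 ^ Kw \<le> (\<theta> * R - R') * real n" "real F \<le> backoff \<theta> * real n"
  shows "admits_code n R' M (real (K * 2 ^ Kw) * r ^ n)"
proof -
  note p = allocation_nonneg(1)[OF alloc]
  obtain slot where slot: "\<And>\<tau>. slot \<tau> \<in> cache_sets"
    and slots: "\<And>S. S \<in> cache_sets \<Longrightarrow>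
      (\<theta> * T (card S) + (1 - \<theta>) / 2 ^ Kw) * real n - 1 \<le> real (card (slots_of slot n S))"
    using ex_slots_of_time_fractions[OF allocation_nonneg(2)[OF alloc] allocation_time[OF alloc] \<theta>,
        of n]
    by blast
  have scaled: "sum_rate (\<lambda>s. \<theta> * p s) S = \<theta> * sum_rate p S" for S by (simp add: sum_rate_def)
  show ?thesis
  proof (rule code_of_piece_rates[OF R' _ _ _ decay slot])
    show "0 \<le> \<theta> * p s" for s using p \<theta> by simp
    show "real n * R' + 2 ^ Kw \<le> real n * (\<Sum>S\<in>cache_sets. \<theta> * p (card S))"
      using n(1) allocation_rate[OF alloc] by (simp add: algebra_simps flip: sum_distrib_left)
    show "real D * (\<Sum>S\<in>cache_sets_with i. \<theta> * p (card S)) \<le> M" if "i < Kw" for i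
    proof -
      have "real D * (\<Sum>S\<in>cache_sets_with i. \<theta> * p (card S))
        \<le> real D * (\<Sum>S\<in>cache_sets_with i. p (card S))"
        using p \<theta> by (intro mult_left_mono sum_mono mult_left_le_one_le) auto
      then show ?thesis using allocation_memory[OF alloc that] by linarith
    qed
    fix S assume S: "S \<in> cache_sets"
    show "real n * sum_rate (\<lambda>s. \<theta> * p s) S
      \<le> capacity dw * real (card (slots_of slot n S)) - backoff \<theta> * real n"
      unfolding scaled using allocation_weak_job[OF alloc S] ds_pos ds_le_dw
      by (intro backoff_absorbs_rounding[OF _ _ _ \<theta> slots[OF S] n(2)]) auto
    have "real n * (\<theta> * (sum_rate p S + real Ks * p (card S)))
      \<le> capacity ds * real (card (slots_of slot n S)) - backoff \<theta> * real n"
      using allocation_strong_job[OF alloc S] ds_pos ds_le_dw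
      by (intro backoff_absorbs_rounding[OF _ _ _ \<theta> slots[OF S] n(2)]) auto
    then show "real n * (sum_rate (\<lambda>s. \<theta> * p s) S + real Ks * (\<theta> * p (card S)))
      \<le> capacity ds * real (card (slots_of slot n S)) - backoff \<theta> * real n"
      unfolding scaled by (simp add: algebra_simps)
  qed
qed

lemma achievable_below_rate_region:
  assumes region: "(R, M) \<in> rate_region" and R': "0 \<le> R'" "R' < R"
  shows "achievable F Kw Ks dw ds D R' M"
proof -
  obtain p T where alloc: "allocation R M p T" using region unfolding rate_region_def by blast
  define \<theta> where "\<theta> = (R' / R + 1) / 2"
  have \<theta>: "0 \<le> \<theta>" "\<theta> < 1" "0 < \<theta> * R - R'"
    unfolding \<theta>_def using R' by (auto simp: field_simps)
  obtain r where decay: "error_decay (backoff \<theta>) r" using ex_error_decay backoff_pos \<theta>(2) by blast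
  show ?thesis
  proof (rule achievableI[OF R'(1)])
    show "(\<lambda>n. real (K * 2 ^ Kw) * r ^ n) \<longlonglongrightarrow> 0"
      using decay unfolding error_decay_def
      by (intro tendsto_mult_right_zero LIMSEQ_realpow_zero) auto
    show "\<forall>\<^sub>F n in sequentially. admits_code n R' M (real (K * 2 ^ Kw) * r ^ n)"
      using eventually_le_mult_real[OF \<theta>(3), of "2 ^ Kw"]
        eventually_le_mult_real[OF backoff_pos[OF \<theta>(2)], of "real F"]
      by eventually_elim (use \<theta> in \<open>intro code_of_allocation[OF alloc R'(1) _ _ decay], auto\<close>)
  qed
qed

lemma rate_region_le_capacity_memory:
  assumes region: "(R, M) \<in> rate_region"
  shows "ereal R \<le> capacity_memory F Kw Ks dw ds D M"
proof (rule dense_le)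
  fix z assume "z < ereal R"
  moreover have "0 < R" using region by (simp add: rate_region_def)
  ultimately obtain R' where R': "max z 0 < ereal R'" "ereal R' < ereal R"
    using ereal_dense2[of "max z 0" "ereal R"] by auto
  then have "achievable F Kw Ks dw ds D R' M"
    by (intro achievable_below_rate_region[OF region]) auto
  then have "ereal R' \<le> capacity_memory F Kw Ks dw ds D M"
    unfolding capacity_memory_def by (intro SUP_upper) simp
  then show "z \<le> capacity_memory F Kw Ks dw ds D M"
    using R'(1) by (meson less_imp_le max_less_iff_conj order_trans)
qed

lemma allocation_convex_combination:
  assumes alloc: "allocation R M p T" "allocation R' M' p' T'" and uv: "0 \<le> u" "0 \<le> v" "u + v = 1"
  shows "allocation (u * R + v * R') (u * M + v * M')
    (\<lambda>s. u * p s + v * p' s) (\<lambda>s. u * T s + v * T' s)"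
proof -
  have mix: "u * a + v * a' \<le> u * b + v * b'" if "a \<le> b" "a' \<le> b'" for a a' b b' :: real
    using that uv by (intro add_mono mult_left_mono)
  have sum_mix: "(\<Sum>S\<in>A. u * f (card S) + v * g (card S))
    = u * (\<Sum>S\<in>A. f (card S)) + v * (\<Sum>S\<in>A. g (card S))"
    for A :: "nat set set" and f g :: "nat \<Rightarrow> real"
    by (simp add: sum.distrib sum_distrib_left)
  show ?thesis unfolding allocation_def sum_mix
  proof (intro conjI allI impI)
    fix s
    show "0 \<le> u * p s + v * p' s" "0 \<le> u * T s + v * T' s"
      using allocation_nonneg[OF alloc(1)] allocation_nonneg[OF alloc(2)] uv by simp_all
    show "u * (\<Sum>S\<in>cache_sets. p (card S)) + v * (\<Sum>S\<in>cache_sets. p' (card S)) = u * R + v * R'"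
      using alloc by (simp add: allocation_rate)
    show "real D * (u * (\<Sum>S\<in>cache_sets_with i. p (card S))
        + v * (\<Sum>S\<in>cache_sets_with i. p' (card S)))
      \<le> u * M + v * M'" if "i < Kw" for i
      using mix[OF allocation_memory[OF alloc(1) that] allocation_memory[OF alloc(2) that]]
      by (simp add: algebra_simps)
    show "u * (\<Sum>S\<in>cache_sets. T (card S)) + v * (\<Sum>S\<in>cache_sets. T' (card S)) \<le> 1"
      using mix[OF allocation_time[OF alloc(1)] allocation_time[OF alloc(2)]] uv(3) by simp
    show "real Ks * (u * p 0 + v * p' 0) \<le> (u * T 0 + v * T' 0) * capacity ds"
      using mix[OF allocation_strong(1)[OF alloc(1)] allocation_strong(1)[OF alloc(2)]]
      by (simp add: algebra_simps)
    assume s: "s < Kw"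
    show "u * p s + v * p' s \<le> (u * T (Suc s) + v * T' (Suc s)) * capacity dw"
      using mix[OF allocation_weak[OF alloc(1) s] allocation_weak[OF alloc(2) s]]
      by (simp add: algebra_simps)
    show "u * p s + v * p' s + real Ks * (u * p (Suc s) + v * p' (Suc s))
      \<le> (u * T (Suc s) + v * T' (Suc s)) * capacity ds"
      using mix[OF allocation_strong(2)[OF alloc(1) s] allocation_strong(2)[OF alloc(2) s]]
      by (simp add: algebra_simps)
  qed
qed

lemma convex_rate_region: "convex rate_region"
proof (rule convexI)
  fix x y :: "real \<times> real" and u v :: real
  assume "x \<in> rate_region" "y \<in> rate_region" and uv: "0 \<le> u" "0 \<le> v" "u + v = 1"
  then obtain R M p T R' M' p' T' where eqs: "x = (R, M)" "y = (R', M')" and pos: "0 < R" "0 < R'"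
    and allocs: "allocation R M p T" "allocation R' M' p' T'"
    unfolding rate_region_def by blast
  have "u *\<^sub>R R + v *\<^sub>R R' \<in> {0<..}"
    using convexD[OF convex_real_interval(3), of R 0 R' u v] pos uv by simp
  then show "u *\<^sub>R x + v *\<^sub>R y \<in> rate_region"
    using allocation_convex_combination[OF allocs uv] unfolding rate_region_def eqs by auto
qed

end

section \<open>Corner points\<close>

lemma sum_Pow_level:
  fixes a :: real
  assumes "finite A"
  shows "(\<Sum>S\<in>Pow A. if card S = v then a else 0) = real (card A choose v) * a"
proof -
  have "(\<Sum>S\<in>Pow A. if card S = v then a else 0) = (\<Sum>S\<in>{S. S \<subseteq> A \<and> card S = v}. a)"
    by (rule sum.mono_neutral_cong_right) (use assms in auto)
  then show ?thesis using n_subsets[OF assms, of v] by simp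
qed

lemma sum_Pow_level_containing:
  fixes a :: real
  assumes "finite A" "i \<in> A"
  shows "real (card A) * (\<Sum>S\<in>{S\<in>Pow A. i \<in> S}. if card S = v then a else 0)
    = real v * (real (card A choose v) * a)"
proof -
  let ?f = "\<lambda>S. if card S = v then a else 0" and ?n = "card A"
  have "{S\<in>Pow A. i \<in> S} = Pow A - Pow (A - {i})" by auto
  then have "(\<Sum>S\<in>{S\<in>Pow A. i \<in> S}. ?f S) = (\<Sum>S\<in>Pow A. ?f S) - (\<Sum>S\<in>Pow (A - {i}). ?f S)"
    using assms(1) by (simp add: sum_diff Pow_mono)
  also have "\<dots> = real (?n choose v) * a - real ((?n - 1) choose v) * a"
    using assms by (simp add: sum_Pow_level)
  finally have "real ?n * (\<Sum>S\<in>{S\<in>Pow A. i \<in> S}. ?f S)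
    = real ?n * real (?n choose v) * a - real (?n * ((?n - 1) choose v)) * a"
    by (simp add: right_diff_distrib)
  also have "real (?n * ((?n - 1) choose v)) = (real ?n - real v) * real (?n choose v)"
    unfolding binomial_absorb_comp[symmetric]
    by (cases "v \<le> ?n") (simp_all add: of_nat_diff binomial_eq_0)
  finally show ?thesis by (simp add: algebra_simps)
qed

context erasure_broadcast
begin

text \<open>For \<open>v > Kw\<close> the division by \<open>Kw choose v = 0\<close> makes this 0.\<close>

definition level_share :: "nat \<Rightarrow> real \<Rightarrow> nat \<Rightarrow> real" where
  "level_share v a s = (if s = v then a / real (Kw choose v) else 0)"

text \<open>The number of sets of size \<open>v + 1\<close> per set of size \<open>v\<close>.\<close>

definition level_ratio :: "nat \<Rightarrow> real" where
  "level_ratio v = (real Kw - real v) / (real v + 1)"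

lemma level_share_nonneg: "0 \<le> a \<Longrightarrow> 0 \<le> level_share v a s"
  by (simp add: level_share_def)

lemma level_share_mult: "level_share v (x * a) s = x * level_share v a s"
  by (simp add: level_share_def)

lemma level_ratio_nonneg: "v \<le> Kw \<Longrightarrow> 0 \<le> level_ratio v"
  by (simp add: level_ratio_def)

lemma level_ratio_Kw: "level_ratio Kw = 0"
  by (simp add: level_ratio_def)

lemma level_share_Suc:
  assumes "s < Kw"
  shows "level_share (Suc v) (level_ratio v * a) (Suc s) = level_share v a s"
proof (cases "s = v")
  case True
  have "real (Suc v * (Kw choose Suc v)) = real ((Kw - v) * (Kw choose v))"
    by (simp only: binomial_absorption binomial_absorb_comp)
  then have "real (Kw choose Suc v) * (real v + 1) = (real Kw - real v) * real (Kw choose v)"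
    using assms True by (simp add: of_nat_diff algebra_simps)
  moreover have pos: "0 < Kw choose v" "0 < Kw choose Suc v" using assms True by simp_all
  ultimately have "level_ratio v = real (Kw choose Suc v) / real (Kw choose v)"
    unfolding level_ratio_def by (subst frac_eq_eq) auto
  then show ?thesis using True pos by (simp add: level_share_def)
qed (simp add: level_share_def)

lemma sum_level_share:
  assumes "v \<le> Kw \<or> a = 0"
  shows "(\<Sum>S\<in>cache_sets. level_share v a (card S)) = a"
  unfolding level_share_def using assms by (auto simp: sum_Pow_level)

lemma sum_level_share_with:
  assumes "v \<le> Kw \<or> a = 0" "i < Kw"
  shows "real Kw * (\<Sum>S\<in>cache_sets_with i. level_share v a (card S)) = real v * a"
  using assms sum_Pow_level_containing[of "{..<Kw}" i v "a / real (Kw choose v)"]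
  unfolding level_share_def by auto

context
  fixes v :: nat and a b :: real
  assumes v: "v \<le> Kw" and ab: "0 \<le> a" "0 \<le> b"
    and piggyback: "real Ks * b * (1 - dw) \<le> level_ratio v * a * (dw - ds)"
begin

text \<open>The pieces of sizes \<open>v\<close> and \<open>v + 1\<close> carry total rates \<open>a\<close> and \<open>b\<close>. The jobs of size \<open>v + 1\<close>
  serve the weak receivers at capacity, so the pieces of size \<open>v + 1\<close> have to fit into what the
  strong receivers can decode beyond that.\<close>

definition two_level_rate :: "nat \<Rightarrow> real" where
  "two_level_rate s = level_share v a s + level_share (Suc v) b s"

definition two_level_time :: "nat \<Rightarrow> real" where
  "two_level_time s = level_share v (real Ks * a) s / capacity ds
    + (level_share (Suc v) (level_ratio v * a) s
      + level_share (Suc (Suc v)) (level_ratio (Suc v) * b) s) / capacity dw"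

lemma upper_level_exists: "Suc v \<le> Kw \<or> b = 0"
proof (rule disjCI)
  assume "b \<noteq> 0"
  then have "0 < real Ks * b * (1 - dw)" using ab Ks_pos dw_less_1 by simp
  then have "level_ratio v \<noteq> 0" using piggyback by auto
  then show "Suc v \<le> Kw" using v level_ratio_Kw by (cases "v = Kw") auto
qed

lemma two_level_time_nonneg: "0 \<le> two_level_time s"
proof -
  have "0 \<le> level_ratio (Suc v) * b" using upper_level_exists ab level_ratio_nonneg by auto
  then show ?thesis
    using ab level_ratio_nonneg[OF v] ds_le_dw dw_less_1
    by (simp add: two_level_time_def level_share_nonneg)
qed

lemma two_level_time_Suc:
  assumes "s < Kw"
  shows "two_level_time (Suc s)
    = real Ks * level_share v a (Suc s) / capacity ds + two_level_rate s / capacity dw"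
  using assms
  by (simp add: two_level_time_def two_level_rate_def level_share_Suc
      level_share_mult[of v "real Ks"])

lemma sum_two_level_rate: "(\<Sum>S\<in>cache_sets. two_level_rate (card S)) = a + b"
  using v upper_level_exists by (simp add: two_level_rate_def sum.distrib sum_level_share)

lemma sum_two_level_rate_with:
  assumes "i < Kw"
  shows "real Kw * (\<Sum>S\<in>cache_sets_with i. two_level_rate (card S)) = real v * a + real (Suc v) * b"
  unfolding two_level_rate_def sum.distrib distrib_left
  using sum_level_share_with[OF disjI1[OF v] assms]
    sum_level_share_with[OF upper_level_exists assms]
  by simp

lemma sum_two_level_time:
  "(\<Sum>S\<in>cache_sets. two_level_time (card S))
    = real Ks * a / capacity ds + (level_ratio v * a + level_ratio (Suc v) * b) / capacity dw"
proof -
  have "Suc v \<le> Kw \<or> level_ratio v * a = 0" "Suc (Suc v) \<le> Kw \<or> level_ratio (Suc v) * b = 0"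
    using v upper_level_exists by (auto simp: level_ratio_def)
  then show ?thesis
    using v by (simp add: two_level_time_def sum.distrib sum_level_share flip: sum_divide_distrib)
qed

lemma two_level_weak:
  assumes s: "s < Kw"
  shows "two_level_rate s \<le> two_level_time (Suc s) * capacity dw"
proof -
  have "0 \<le> real Ks * level_share v a (Suc s) / capacity ds * capacity dw"
    using ab ds_le_dw dw_less_1
    by (intro mult_nonneg_nonneg divide_nonneg_nonneg level_share_nonneg) auto
  then show ?thesis
    unfolding two_level_time_Suc[OF s] distrib_right[of _ _ "capacity dw"]
    using F_pos dw_less_1 by simp
qed

lemma two_level_strong:
  assumes s: "s < Kw"
  shows "two_level_rate s + real Ks * two_level_rate (Suc s) \<le> two_level_time (Suc s) * capacity ds"
proof -
  have Cw: "0 < capacity dw" by (rule capacity_pos[OF dw_less_1])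
  have "real Ks * level_share (Suc v) b (Suc s) * (1 - dw) \<le> level_share v a s * (dw - ds)"
    unfolding level_share_Suc[OF s, symmetric] using piggyback
    by (simp add: level_share_def divide_right_mono)
  then have "real F * (real Ks * level_share (Suc v) b (Suc s) * (1 - dw))
    \<le> real F * (level_share v a s * (dw - ds))"
    by (rule mult_left_mono) simp
  then have "(level_share v a s + real Ks * level_share (Suc v) b (Suc s)) * capacity dw
    \<le> level_share v a s * capacity ds"
    by (simp add: algebra_simps)
  moreover have "level_share (Suc v) b s * capacity dw \<le> level_share (Suc v) b s * capacity ds"
    using ds_le_dw ab by (intro mult_left_mono level_share_nonneg) auto
  ultimately have "two_level_rate s + real Ks * level_share (Suc v) b (Suc s)
    \<le> two_level_rate s / capacity dw * capacity ds"
    using Cw by (simp add: two_level_rate_def pos_le_divide_eq distrib_right)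
  then show ?thesis
    unfolding two_level_time_Suc[OF s]
    using F_pos ds_le_dw dw_less_1 by (simp add: two_level_rate_def distrib_left distrib_right)
qed

lemma two_level_allocation:
  assumes memory: "real D * (real v * a + real (Suc v) * b) \<le> real Kw * M"
    and time: "real Ks * a / capacity ds
      + (level_ratio v * a + level_ratio (Suc v) * b) / capacity dw \<le> 1"
  shows "allocation (a + b) M two_level_rate two_level_time"
  unfolding allocation_def
proof (intro conjI allI impI)
  fix s i
  show "0 \<le> two_level_rate s" using ab by (simp add: two_level_rate_def level_share_nonneg)
  show "real Ks * two_level_rate 0 \<le> two_level_time 0 * capacity ds"
    using F_pos ds_le_dw dw_less_1
    by (simp add: two_level_rate_def two_level_time_def level_share_def)
  show "real D * (\<Sum>S\<in>cache_sets_with i. two_level_rate (card S)) \<le> M" if i: "i < Kw"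
  proof -
    have "real Kw * (real D * (\<Sum>S\<in>cache_sets_with i. two_level_rate (card S))) \<le> real Kw * M"
      using memory by (simp only: mult.left_commute[of "real Kw"] sum_two_level_rate_with[OF i])
    then show ?thesis using i by (simp add: mult_le_cancel_left_pos)
  qed
qed (use time in \<open>simp_all only: two_level_time_nonneg sum_two_level_rate sum_two_level_time
    two_level_weak two_level_strong\<close>)

end

lemma no_cache_point_in_rate_region:
  "(Rpt F Kw Ks dw ds 0, Mpt F Kw Ks dw ds D 0) \<in> rate_region"
proof -
  let ?R = "Rpt F Kw Ks dw ds 0"
  define Q where "Q = real Kw / (1 - dw) + real Ks / (1 - ds)"
  have "0 < Q" unfolding Q_def using Ks_pos ds_le_dw dw_less_1 by (intro add_nonneg_pos) auto
  have R: "?R = real F / Q" by (simp add: Rpt_def Q_def)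
  have "0 < ?R" unfolding R using F_pos \<open>0 < Q\<close> by simp
  have "real Ks * ?R / capacity ds + level_ratio 0 * ?R / capacity dw = ?R * (Q / real F)"
    by (simp add: Q_def level_ratio_def add_divide_distrib distrib_left mult_ac)
  also have "\<dots> = 1" unfolding R using F_pos \<open>0 < Q\<close> by simp
  finally have "allocation (?R + 0) (Mpt F Kw Ks dw ds D 0)
    (two_level_rate 0 ?R 0) (two_level_time 0 ?R 0)"
    using \<open>0 < ?R\<close> ds_le_dw level_ratio_nonneg[of 0]
    by (intro two_level_allocation) (auto simp: Mpt_def)
  then show ?thesis using \<open>0 < ?R\<close> unfolding rate_region_def by auto
qed

lemma full_cache_point_in_rate_region:
  "(Rpt F Kw Ks dw ds (Kw + 1), Mpt F Kw Ks dw ds D (Kw + 1)) \<in> rate_region"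
proof -
  let ?R = "Rpt F Kw Ks dw ds (Kw + 1)"
  have R: "?R = capacity ds / real Ks" by (simp add: Rpt_def)
  have "0 < ?R" unfolding R using Ks_pos capacity_pos ds_le_dw dw_less_1 by simp
  moreover have "Mpt F Kw Ks dw ds D (Kw + 1) = real D * ?R" unfolding R by (simp add: Mpt_def)
  moreover have "real Ks * ?R / capacity ds = 1"
    unfolding R using F_pos Ks_pos ds_le_dw dw_less_1 by simp
  ultimately have "allocation (?R + 0) (Mpt F Kw Ks dw ds D (Kw + 1))
    (two_level_rate Kw ?R 0) (two_level_time Kw ?R 0)"
    by (intro two_level_allocation) (auto simp: level_ratio_Kw)
  then show ?thesis using \<open>0 < ?R\<close> unfolding rate_region_def by auto
qed

lemma corner_point_eqs:
  assumes t: "1 \<le> t" "t \<le> Kw"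
  defines "g \<equiv> (dw - ds) / (1 - dw)"
  defines "\<xi> \<equiv> level_ratio (t - 1) / real Ks * g"
  defines "a \<equiv> capacity dw / (level_ratio (t - 1) * (1 + level_ratio t / real Ks * g)
    + real Ks * (1 - dw) / (1 - ds))"
  shows "Rpt F Kw Ks dw ds t = a + \<xi> * a"
    and "Mpt F Kw Ks dw ds D t = real D / real Kw * (real (t - 1) * a + real t * (\<xi> * a))"
proof -
  have ratio: "level_ratio (t - 1) = (real Kw - real t + 1) / real t"
    using t by (simp add: level_ratio_def of_nat_diff)
  have "0 \<le> \<xi>"
    unfolding \<xi>_def g_def using level_ratio_nonneg[of "t - 1"] t ds_le_dw dw_less_1 by simp
  have R: "Rpt F Kw Ks dw ds t = a * (1 + \<xi>)"
    using t unfolding Rpt_def a_def \<xi>_def g_def ratio level_ratio_def[of t]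
    by (simp add: Let_def mult_ac)
  then show "Rpt F Kw Ks dw ds t = a + \<xi> * a" by (simp add: algebra_simps)
  have "Mpt F Kw Ks dw ds D t = a * (1 + \<xi>) * real D / real Kw * (real t - 1 / (1 + \<xi>))"
    using t unfolding Mpt_def R \<xi>_def g_def ratio by (simp add: Let_def mult_ac)
  also have "\<dots> = real D / real Kw * (a * ((1 + \<xi>) * (real t - 1 / (1 + \<xi>))))"
    by simp
  also have "(1 + \<xi>) * (real t - 1 / (1 + \<xi>)) = (1 + \<xi>) * real t - 1"
    using \<open>0 \<le> \<xi>\<close> by (simp add: right_diff_distrib)
  also have "a * ((1 + \<xi>) * real t - 1) = real (t - 1) * a + real t * (\<xi> * a)"
    using t by (simp add: of_nat_diff algebra_simps)
  finally show "Mpt F Kw Ks dw ds D t = real D / real Kw * (real (t - 1) * a + real t * (\<xi> * a))" .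
qed

lemma intermediate_point_in_rate_region:
  assumes t: "1 \<le> t" "t \<le> Kw"
  shows "(Rpt F Kw Ks dw ds t, Mpt F Kw Ks dw ds D t) \<in> rate_region"
proof -
  let ?g = "(dw - ds) / (1 - dw)" and ?A = "level_ratio (t - 1)" and ?B = "level_ratio t"
  define \<xi> where "\<xi> = ?A / real Ks * ?g"
  define Q where "Q = ?A * (1 + ?B / real Ks * ?g) + real Ks * (1 - dw) / (1 - ds)"
  define a where "a = capacity dw / Q"
  note eqs = corner_point_eqs[OF t, folded \<xi>_def Q_def, folded a_def]
  have ratios: "0 \<le> ?A" "0 \<le> ?B" and g: "0 \<le> ?g"
    using level_ratio_nonneg t ds_le_dw dw_less_1 by simp_all
  have "0 \<le> \<xi>" unfolding \<xi>_def using ratios g Ks_pos by (intro mult_nonneg_nonneg) auto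
  have "0 < Q"
    unfolding Q_def using ratios g Ks_pos ds_le_dw dw_less_1 by (intro add_nonneg_pos) auto
  then have "0 < a" using capacity_pos[OF dw_less_1] by (simp add: a_def)
  have "allocation (a + \<xi> * a) (Mpt F Kw Ks dw ds D t)
    (two_level_rate (t - 1) a (\<xi> * a)) (two_level_time (t - 1) a (\<xi> * a))"
  proof (rule two_level_allocation)
    show "real Ks * (\<xi> * a) * (1 - dw) \<le> ?A * a * (dw - ds)"
      using Ks_pos dw_less_1 by (simp add: \<xi>_def)
    show "real D * (real (t - 1) * a + real (Suc (t - 1)) * (\<xi> * a))
      \<le> real Kw * Mpt F Kw Ks dw ds D t"
      unfolding eqs(2) using t by simp
    have "real Ks * a / capacity ds + (?A * a + ?B * (\<xi> * a)) / capacity dw = a * (Q / capacity dw)"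
      using F_pos dw_less_1
      by (simp add: Q_def \<xi>_def add_divide_distrib distrib_left mult_ac)
    also have "\<dots> = 1" unfolding a_def using \<open>0 < Q\<close> F_pos dw_less_1 by simp
    finally show "real Ks * a / capacity ds
      + (?A * a + level_ratio (Suc (t - 1)) * (\<xi> * a)) / capacity dw \<le> 1"
      using t by simp
  qed (use t \<open>0 < a\<close> \<open>0 \<le> \<xi>\<close> in auto)
  moreover have "0 < a + \<xi> * a" using \<open>0 < a\<close> \<open>0 \<le> \<xi>\<close> by (intro add_pos_nonneg) auto
  ultimately show ?thesis unfolding rate_region_def eqs(1) by blast
qed

lemma corner_points_in_rate_region:
  assumes "t \<le> Kw + 1"
  shows "(Rpt F Kw Ks dw ds t, Mpt F Kw Ks dw ds D t) \<in> rate_region"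
proof -
  consider "t = 0" | "1 \<le> t" "t \<le> Kw" | "t = Kw + 1" using assms by linarith
  then show ?thesis
    using no_cache_point_in_rate_region intermediate_point_in_rate_region
      full_cache_point_in_rate_region
    by cases blast+
qed

end

theorem theorem1:
  fixes F Kw Ks D :: nat and dw ds M :: real
  assumes "1 \<le> F" and "1 \<le> Ks" and "0 < ds" and "ds \<le> dw" and "dw < 1"
    and "Kw + Ks \<le> D"
  shows "upper_convex_hull (Rpt F Kw Ks dw ds) (Mpt F Kw Ks dw ds D) (Kw + 1) M
           \<le> capacity_memory F Kw Ks dw ds D M"
proof -
  interpret erasure_broadcast F Kw Ks D dw ds using assms(1-5) by unfold_locales
  show ?thesis unfolding upper_convex_hull_def
  proof (rule SUP_least)
    let ?R = "Rpt F Kw Ks dw ds" and ?M = "Mpt F Kw Ks dw ds D"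
    fix l :: "nat \<Rightarrow> real"
    assume "l \<in> {l. (\<forall>t\<le>Kw + 1. 0 \<le> l t) \<and> (\<Sum>t\<le>Kw + 1. l t) = 1 \<and> (\<Sum>t\<le>Kw + 1. l t * ?M t) = M}"
    then have l: "(\<Sum>t\<le>Kw + 1. l t) = 1" "\<And>t. t \<in> {..Kw + 1} \<Longrightarrow> 0 \<le> l t"
      and M: "(\<Sum>t\<le>Kw + 1. l t * ?M t) = M" by auto
    have "(\<Sum>t\<le>Kw + 1. l t *\<^sub>R (?R t, ?M t)) \<in> rate_region"
      by (rule convex_sum[OF _ convex_rate_region l]) (simp_all add: corner_points_in_rate_region)
    also have "(\<Sum>t\<le>Kw + 1. l t *\<^sub>R (?R t, ?M t)) = (\<Sum>t\<le>Kw + 1. l t * ?R t, M)"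
      by (simp add: sum_prod flip: M)
    finally show "ereal (\<Sum>t\<le>Kw + 1. l t * ?R t) \<le> capacity_memory F Kw Ks dw ds D M"
      by (rule rate_region_le_capacity_memory)
  qed
qed

end
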